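(* Suppose $x\in\mathcal{X}_{\mathrm{free}}$ and $\xi\in\mathcal{X}$, $\xi\ne0$, with $h_F(x,\xi)>0$. Then for all $r>0$ there exists $\rho>0$ such that $$\big(\partial\mathcal{R}_\rho(x)\cap\partial\mathcal{R}_\mu(x)\cap B_r(x)\big)\setminus\{x\}\ne\emptyset\qquad\text{for all }0<\mu<\rho,$$ and $$\big(\partial\mathcal{F}_\rho(x)\cap\partial\mathcal{F}_\mu(x)\cap B_r(x)\big)\setminus\{x\}\ne\emptyset\qquad\text{for all }0<\mu<\rho.$$
   Context: Setting. $\mathcal{X}\subseteq\mathbb{R}^n$ is the state space, with inner product $\langle\cdot,\cdot\rangle$ and norm $\|\cdot\|$; $B_r(x)=\{y\in\mathcal{X}:\|x-y\|<r\}$. $F:\mathcal{X}\rightrightarrows\mathcal{X}$ is a set-valued map (the admissible velocities $F(x)=\{f(x,u):u\in\mathcal{U}\}$ of a control system with state function $f$ and control space $\mathcal{U}\subseteq\mathbb{R}^m$) satisfying: (SH1) each $F(x)$ is nonempty and convex, the graph $\{(x,v):v\in F(x)\}$ is closed in $\mathcal{X}^2$, and for each compact $K\subset\mathcal{X}$ there is $M>0$ with $\|v\|\le M$ whenever $x\in K$, $v\in F(x)$; (SH2) there are $\gamma,c>0$ with $\|v\|\le\gamma\|x\|+c$ for all $x\in\mathcal{X}$, $v\in F(x)$; (SH3) for each compact $K\subset\mathcal{X}$ there is $k>0$ with $F(x)\subseteq F(y)+k\|x-y\|\overline{B_1(0)}$ for all $x,y\in K$. The minimal Hamiltonian is $h_F(x,\xi):=\inf_{v\in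 F(x)}\langle v,\xi\rangle$. The running cost $\psi:\mathcal{X}^2\to(0,\infty)$ is continuous. Obstacles and trajectories. $\mathcal{O}\subset\mathcal{X}$ is a closed set (obstacle), $\mathcal{X}_{\mathrm{free}}:=\mathcal{X}\setminus\mathcal{O}$. $\Pi(x,y)$ is the set of absolutely continuous $\pi:[0,T_\pi]\to\mathcal{X}$ (some $T_\pi\ge0$) with $\dot\pi(t)\in F(\pi(t))$ for a.e. $t$, $\pi(0)=x$, $\pi(T_\pi)=y$, and $\pi(t)\in\overline{\mathcal{X}_{\mathrm{free}}}$ for all $t\in[0,T_\pi]$. The cost of $\pi$ is $c_\pi:=\int_0^{T_\pi}\psi(\pi(t),\dot\pi(t))\,dt$. Derived notions. $d_c(x,y):=\inf\{c_\pi:\pi\in\Pi(x,y)\}$ ($=\infty$ if $\Pi(x,y)=\emptyset$); forward reachable set $\mathcal{F}_\rho(x):=\{y\in\mathcal{X}:d_c(x,y)<\rho\}$; reverse reachable set $\mathcal{R}_\rho(x):=\{y\in\mathcal{X}:d_c(y,x)<\rho\}$. $\partial$ denotes topological boundary in $\mathcal{X}$.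
   Formalization: The formal theorem additionally assumes that n ≥ 2, that the state space X is closed in R^n, and that x is an interior point of X; the claim is false for n = 1 and can fail for non-closed X or non-interior x, while the last two are automatic when X = R^n. *)

theory Defs
  imports "HOL-Analysis.Analysis"
begin

(* The set-valued map F is a function into sets; only its values on the state space X matter.
   In SH3 the ball is the closed unit ball of the ambient space, so that the sum makes sense
   whether or not 0 lies in X. *)

definition SH1 :: "'a::euclidean_space set \<Rightarrow> ('a \<Rightarrow> 'a set) \<Rightarrow> bool" where
  "SH1 X F \<longleftrightarrow>
     (\<forall>x\<in>X. F x \<noteq> {} \<and> convex (F x)) \<and>
     closedin (top_of_set (X \<times> X)) {(x, v). x \<in> X \<and> v \<in> F x} \<and>
     (\<forall>K\<subseteq>X. compact K \<longrightarrow> (\<exists>M>0. \<forall>x\<in>K. \<forall>v\<in>F x. norm v \<le> M))"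

definition SH2 :: "'a::euclidean_space set \<Rightarrow> ('a \<Rightarrow> 'a set) \<Rightarrow> bool" where
  "SH2 X F \<longleftrightarrow> (\<exists>\<gamma>>0. \<exists>c>0. \<forall>x\<in>X. \<forall>v\<in>F x. norm v \<le> \<gamma> * norm x + c)"

definition SH3 :: "'a::euclidean_space set \<Rightarrow> ('a \<Rightarrow> 'a set) \<Rightarrow> bool" where
  "SH3 X F \<longleftrightarrow>
     (\<forall>K\<subseteq>X. compact K \<longrightarrow>
        (\<exists>k>0. \<forall>x\<in>K. \<forall>y\<in>K.
           F x \<subseteq> {w + (k * norm (x - y)) *\<^sub>R b | w b. w \<in> F y \<and> b \<in> cball 0 1}))"

(* A real infimum; it is the mathematical one when F x is nonempty and bounded, as under SH1. *)
definition min_hamiltonian :: "('a::euclidean_space \<Rightarrow> 'a set) \<Rightarrow> 'a \<Rightarrow> 'a \<Rightarrow> real" where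
  "min_hamiltonian F x \<xi> = (INF v\<in>F x. v \<bullet> \<xi>)"

definition abs_continuous_on :: "real \<Rightarrow> real \<Rightarrow> (real \<Rightarrow> 'a::euclidean_space) \<Rightarrow> bool" where
  "abs_continuous_on a b \<pi> \<longleftrightarrow>
     (\<forall>\<epsilon>>0. \<exists>\<delta>>0. \<forall>D :: (real \<times> real) set.
        finite D \<and> (\<forall>(s, t)\<in>D. a \<le> s \<and> s \<le> t \<and> t \<le> b) \<and>
        disjoint_family_on (\<lambda>(s, t). {s<..<t}) D \<and>
        (\<Sum>(s, t)\<in>D. t - s) < \<delta>
        \<longrightarrow> (\<Sum>(s, t)\<in>D. norm (\<pi> t - \<pi> s)) < \<epsilon>)"

(* A trajectory is a pair of its duration and a function on the reals, of which only the
   restriction to the interval from 0 to the duration is relevant. *)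
definition trajectories ::
  "'a::euclidean_space set \<Rightarrow> ('a \<Rightarrow> 'a set) \<Rightarrow> 'a set \<Rightarrow> 'a \<Rightarrow> 'a \<Rightarrow> (real \<times> (real \<Rightarrow> 'a)) set" where
  "trajectories X F Obs x y =
     {(T, \<pi>). 0 \<le> T \<and> abs_continuous_on 0 T \<pi> \<and>
        (AE t in lebesgue_on {0..T}.
           \<exists>v\<in>F (\<pi> t). (\<pi> has_vector_derivative v) (at t within {0..T})) \<and>
        \<pi> 0 = x \<and> \<pi> T = y \<and>
        (\<forall>t\<in>{0..T}. \<pi> t \<in> X \<inter> closure (X - Obs))}"

definition path_cost ::
  "('a::euclidean_space \<times> 'a \<Rightarrow> real) \<Rightarrow> real \<times> (real \<Rightarrow> 'a) \<Rightarrow> ennreal" where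
  "path_cost \<psi> = (\<lambda>(T, \<pi>).
     \<integral>\<^sup>+ t. ennreal (\<psi> (\<pi> t, vector_derivative \<pi> (at t within {0..T}))) \<partial>lebesgue_on {0..T})"

definition cost_dist ::
  "'a::euclidean_space set \<Rightarrow> ('a \<Rightarrow> 'a set) \<Rightarrow> 'a set \<Rightarrow> ('a \<times> 'a \<Rightarrow> real) \<Rightarrow> 'a \<Rightarrow> 'a \<Rightarrow> ennreal" where
  "cost_dist X F Obs \<psi> x y = (INF p\<in>trajectories X F Obs x y. path_cost \<psi> p)"

definition forward_reach ::
  "'a::euclidean_space set \<Rightarrow> ('a \<Rightarrow> 'a set) \<Rightarrow> 'a set \<Rightarrow> ('a \<times> 'a \<Rightarrow> real) \<Rightarrow> real \<Rightarrow> 'a \<Rightarrow> 'a set" where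
  "forward_reach X F Obs \<psi> \<rho> x = {y\<in>X. cost_dist X F Obs \<psi> x y < ennreal \<rho>}"

definition reverse_reach ::
  "'a::euclidean_space set \<Rightarrow> ('a \<Rightarrow> 'a set) \<Rightarrow> 'a set \<Rightarrow> ('a \<times> 'a \<Rightarrow> real) \<Rightarrow> real \<Rightarrow> 'a \<Rightarrow> 'a set" where
  "reverse_reach X F Obs \<psi> \<rho> x = {y\<in>X. cost_dist X F Obs \<psi> y x < ennreal \<rho>}"

end

(* Near x every admissible velocity v satisfies v \<bullet> \<xi> \<ge> h for some h > 0, while speed and running cost
   are bounded above and the running cost is bounded below by a positive constant. Hence a trajectory
   through x of small cost stays in a ball around x, and its elapsed time, its length and its cost
   are all at most a constant times the height difference along \<xi>. So the points of small cost lie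
   in a cone with apex x, and on a hyperplane orthogonal to \<xi> at small height s every point of
   cost below \<rho> already has cost below \<mu>. Such a hyperplane contains a reachable point, given by an
   integral curve of the least-norm selection of F (Peano), and, in dimension at least two,
   a point outside the cone; on the segment between them lies a common frontier point. *)

theory Submission
  imports Defs "HOL-Complex_Analysis.Great_Picard"
begin

text \<open>One ball around \<open>x\<close>, clear of the obstacle, carries the whole argument, and
  \<rho> is a lower bound for the cost of travelling inside it from the centre to the sphere. So
  \<rho> depends on the ball only and serves every \<open>r\<close>, which merely limits the height
  \<open>s\<close>. The two frontiers are matched without computing either of them: on the open
  half-space where \<open>C\<close> times the height is below \<mu>, the two sublevel sets coincide,
  hence so do their frontiers there. Two obstacles shape the rest. Trajectories are only absolutely
  continuous and satisfy the inclusion almost everywhere, so bounds on velocities must be turned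
  into bounds on increments across a null set. And a reachable point at a given height requires a
  trajectory to exist: SH3 makes \<open>F\<close> Lipschitz as a set-valued map, but the estimate
  for least-norm points gives the selection only Hoelder exponent one half, so a theorem for
  Lipschitz vector fields cannot be applied to it.\<close>

section \<open>Absolutely continuous functions and their increments\<close>

lemma abs_continuous_on_subset:
  assumes "abs_continuous_on a b f" "a \<le> c" "d \<le> b"
  shows "abs_continuous_on c d f"
  unfolding abs_continuous_on_def
proof (intro allI impI)
  fix \<epsilon> :: real assume "\<epsilon> > 0"
  then obtain \<delta> where "\<delta> > 0" and \<delta>: "\<And>D. finite D \<and> (\<forall>(s, t)\<in>D. a \<le> s \<and> s \<le> t \<and> t \<le> b) \<and>
      disjoint_family_on (\<lambda>(s, t). {s<..<t}) D \<and> (\<Sum>(s, t)\<in>D. t - s) < \<delta>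
      \<Longrightarrow> (\<Sum>(s, t)\<in>D. norm (f t - f s)) < \<epsilon>"
    using assms(1) unfolding abs_continuous_on_def by meson
  have "(\<Sum>(s, t)\<in>D. norm (f t - f s)) < \<epsilon>"
    if "finite D \<and> (\<forall>(s, t)\<in>D. c \<le> s \<and> s \<le> t \<and> t \<le> d) \<and>
      disjoint_family_on (\<lambda>(s, t). {s<..<t}) D \<and> (\<Sum>(s, t)\<in>D. t - s) < \<delta>" for D
    using that assms(2,3) by (intro \<delta>) fastforce
  with \<open>\<delta> > 0\<close> show "\<exists>\<delta>>0. \<forall>D. finite D \<and> (\<forall>(s, t)\<in>D. c \<le> s \<and> s \<le> t \<and> t \<le> d) \<and>
      disjoint_family_on (\<lambda>(s, t). {s<..<t}) D \<and> (\<Sum>(s, t)\<in>D. t - s) < \<delta>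
      \<longrightarrow> (\<Sum>(s, t)\<in>D. norm (f t - f s)) < \<epsilon>"
    by blast
qed

lemma abs_continuous_on_imp_continuous_on:
  assumes "abs_continuous_on a b f"
  shows "continuous_on {a..b} f"
  unfolding continuous_on_iff
proof (intro ballI allI impI)
  fix t \<epsilon> :: real assume t: "t \<in> {a..b}" and "\<epsilon> > 0"
  then obtain \<delta> where "\<delta> > 0" and \<delta>: "\<And>D. finite D \<and> (\<forall>(s, t)\<in>D. a \<le> s \<and> s \<le> t \<and> t \<le> b) \<and>
      disjoint_family_on (\<lambda>(s, t). {s<..<t}) D \<and> (\<Sum>(s, t)\<in>D. t - s) < \<delta>
      \<Longrightarrow> (\<Sum>(s, t)\<in>D. norm (f t - f s)) < \<epsilon>"
    using assms unfolding abs_continuous_on_def by meson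
  have "norm (f r - f s) < \<epsilon>" if "a \<le> s" "s \<le> r" "r \<le> b" "r - s < \<delta>" for r s
    using \<delta>[of "{(s, r)}"] that by (simp add: disjoint_family_on_def)
  from this[of s t for s] this[of t s for s]
  have "dist (f s) (f t) < \<epsilon>" if "s \<in> {a..b}" "dist s t < \<delta>" for s
    using that t by (cases "s \<le> t") (auto simp: dist_norm norm_minus_commute)
  with \<open>\<delta> > 0\<close> show "\<exists>d>0. \<forall>s\<in>{a..b}. dist s t < d \<longrightarrow> dist (f s) (f t) < \<epsilon>"
    by blast
qed

lemma lipschitz_imp_abs_continuous_on:
  fixes f :: "real \<Rightarrow> 'a::euclidean_space"
  assumes lip: "\<And>s t. \<lbrakk>a \<le> s; s \<le> t; t \<le> b\<rbrakk> \<Longrightarrow> norm (f t - f s) \<le> M * (t - s)"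
  shows "abs_continuous_on a b f"
  unfolding abs_continuous_on_def
proof (intro allI impI)
  fix \<epsilon> :: real assume "\<epsilon> > 0"
  define B where "B = \<bar>M\<bar> + 1"
  have "B > 0" by (simp add: B_def add_nonneg_pos)
  show "\<exists>\<delta>>0. \<forall>D :: (real \<times> real) set.
        finite D \<and> (\<forall>(s, t)\<in>D. a \<le> s \<and> s \<le> t \<and> t \<le> b) \<and>
        disjoint_family_on (\<lambda>(s, t). {s<..<t}) D \<and> (\<Sum>(s, t)\<in>D. t - s) < \<delta>
        \<longrightarrow> (\<Sum>(s, t)\<in>D. norm (f t - f s)) < \<epsilon>"
  proof (intro exI[of _ "\<epsilon> / B"] conjI allI impI)
    show "0 < \<epsilon> / B" using \<open>\<epsilon> > 0\<close> \<open>B > 0\<close> by simp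
    fix D :: "(real \<times> real) set"
    assume D: "finite D \<and> (\<forall>(s, t)\<in>D. a \<le> s \<and> s \<le> t \<and> t \<le> b) \<and>
        disjoint_family_on (\<lambda>(s, t). {s<..<t}) D \<and> (\<Sum>(s, t)\<in>D. t - s) < \<epsilon> / B"
    have "norm (f t - f s) \<le> B * (t - s)" if "(s, t) \<in> D" for s t
    proof -
      have "norm (f t - f s) \<le> M * (t - s)" using D that lip by fast
      also have "\<dots> \<le> B * (t - s)" using D that by (intro mult_right_mono) (auto simp: B_def)
      finally show ?thesis .
    qed
    then have "(\<Sum>(s, t)\<in>D. norm (f t - f s)) \<le> (\<Sum>(s, t)\<in>D. B * (t - s))"
      by (intro sum_mono) auto
    also have "\<dots> = B * (\<Sum>(s, t)\<in>D. t - s)"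
      by (simp add: sum_distrib_left case_prod_unfold)
    also have "\<dots> < \<epsilon>"
      using D \<open>B > 0\<close> by (simp add: pos_less_divide_eq mult.commute)
    finally show "(\<Sum>(s, t)\<in>D. norm (f t - f s)) < \<epsilon>" .
  qed
qed

text \<open>On a fine tagged division, intervals tagged outside \<open>N\<close> are controlled by the derivative;
  those tagged in \<open>N\<close> lie in an open set of small measure and are controlled by absolute continuity.\<close>

lemma abs_continuous_increment_ge:
  fixes f :: "real \<Rightarrow> 'a::euclidean_space"
  assumes "a \<le> b" and ac: "abs_continuous_on a b f" and N: "negligible N"
    and der: "\<And>t. t \<in> {a..b} - N \<Longrightarrow>
      \<exists>v. (f has_vector_derivative v) (at t within {a..b}) \<and> c \<le> v \<bullet> u"
  shows "c * (b - a) \<le> (f b - f a) \<bullet> u"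
proof -
  define G where "G t = f t \<bullet> u" for t
  \<comment> \<open>\<open>Q\<close> collects the errors, each a multiple of \<open>e\<close>:
    \<open>b - a\<close> from replacing \<open>c\<close> by \<open>c - e\<close>, and
    \<open>norm u\<close> and \<open>\<bar>c\<bar> + 1\<close> from the increments and the lengths
    of the intervals tagged in \<open>N\<close>.\<close>
  define Q where "Q = (b - a) + norm u + \<bar>c\<bar> + 1"
  have "Q > 0"
    using \<open>a \<le> b\<close> by (simp add: Q_def add_nonneg_pos)
  have main: "c * (b - a) - e * Q \<le> G b - G a" if e: "0 < e" "e \<le> 1" for e
  proof -
    have "\<exists>d>0. \<forall>s\<in>{a..b}. t \<in> {a..b} - N \<longrightarrow> \<bar>s - t\<bar> < d \<longrightarrow>
       (\<exists>v\<ge>c. \<bar>G s - G t - (s - t) * v\<bar> \<le> e * \<bar>s - t\<bar>)" for t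
    proof (cases "t \<in> {a..b} - N")
      case True
      then obtain v where v: "(f has_vector_derivative v) (at t within {a..b})" "c \<le> v \<bullet> u"
        using der by blast
      have "(G has_vector_derivative (v \<bullet> u)) (at t within {a..b})"
        unfolding G_def using bounded_linear.has_vector_derivative[OF bounded_linear_inner_left v(1)] .
      then show ?thesis
        using e(1) v(2) by (simp add: has_vector_derivative_def has_derivative_within_alt) blast
    qed (use zero_less_one in blast)
    then obtain d where d0: "\<And>t. d t > 0"
      and d: "\<And>s t. \<lbrakk>s \<in> {a..b}; t \<in> {a..b} - N; \<bar>s - t\<bar> < d t\<rbrakk> \<Longrightarrow>
          \<exists>v\<ge>c. \<bar>G s - G t - (s - t) * v\<bar> \<le> e * \<bar>s - t\<bar>"
      by metis
    obtain \<delta> where "\<delta> > 0" and \<delta>: "\<And>D :: (real \<times> real) set.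
        finite D \<and> (\<forall>(s, t)\<in>D. a \<le> s \<and> s \<le> t \<and> t \<le> b) \<and>
        disjoint_family_on (\<lambda>(s, t). {s<..<t}) D \<and> (\<Sum>(s, t)\<in>D. t - s) < \<delta>
        \<Longrightarrow> (\<Sum>(s, t)\<in>D. norm (f t - f s)) < e"
      using ac e(1) unfolding abs_continuous_on_def by meson
    have "N \<in> sets lebesgue"
      using N negligible_imp_sets by blast
    moreover have "min \<delta> e > 0"
      using \<open>\<delta> > 0\<close> e by simp
    \<comment> \<open>Measure below \<delta> makes absolute continuity applicable; measure below
      \<open>e\<close> bounds the total length of the intervals tagged in \<open>N\<close>, on which
      the required growth \<open>c - e\<close> may fail.\<close>
    ultimately obtain U where U: "open U" "N \<subseteq> U" "U - N \<in> lmeasurable"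
        "emeasure lebesgue (U - N) < ennreal (min \<delta> e)"
      using sets_lebesgue_outer_open by metis
    have "U = (U - N) \<union> N" using U by auto
    then have emU: "emeasure lebesgue U < ennreal (min \<delta> e)"
      using emeasure_Un_null_set[of "U - N" lebesgue N] U N
      by (metis fmeasurableD negligible_iff_null_sets)
    have "U \<in> lmeasurable"
      using emU U(1) by (intro fmeasurableI) (auto simp: less_top[symmetric] elim: order.strict_trans)
    then have mU: "measure lebesgue U < min \<delta> e"
      using emU \<open>min \<delta> e > 0\<close> by (simp add: emeasure_eq_measure2 ennreal_less_iff)
    define g where "g t = (if t \<in> N then U else ball t (d t))" for t
    have "gauge g"
      using U d0 by (auto simp: gauge_def g_def)
    then obtain p where p: "p tagged_division_of {a..b}" and fine: "g fine p"
      using fine_division_exists_real by blast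
    have fin: "finite p"
      using p by blast
    have K: "t \<in> K \<and> K = {Inf K..Sup K} \<and> a \<le> Inf K \<and> Inf K \<le> t \<and> t \<le> Sup K \<and> Sup K \<le> b"
      if tK: "(t, K) \<in> p" for t K
    proof -
      obtain \<alpha> \<beta> where "K = cbox \<alpha> \<beta>"
        using tagged_division_ofD(4)[OF p tK] by blast
      moreover have "t \<in> K" "K \<subseteq> {a..b}"
        using tagged_division_ofD(2,3)[OF p tK] by auto
      ultimately show ?thesis by auto
    qed
    \<comment> \<open>Degenerate intervals contribute nothing and are left out so that
      \<open>h\<close> is injective: two members of \<open>P\<close> with equal endpoints would
      share a nonempty interior.\<close>
    define P where "P = {(t, K) \<in> p. t \<in> N \<and> Inf K < Sup K}"
    define h where "h = (\<lambda>(t::real, K::real set). (Inf K, Sup K))"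
    define D where "D = h ` P"
    have intr: "interior K = {Inf K<..<Sup K}" if "(t, K) \<in> p" for t K
      using K[OF that] by (metis interior_atLeastAtMost_real)
    have disj: "{Inf K<..<Sup K} \<inter> {Inf L<..<Sup L} = {}"
      if "(t, K) \<in> p" "(s, L) \<in> p" "(t, K) \<noteq> (s, L)" for t K s L
      using tagged_division_ofD(5)[OF p that] intr that by metis
    have inj: "inj_on h P"
    proof (rule inj_onI)
      fix y z assume "y \<in> P" "z \<in> P" "h y = h z"
      then obtain t K s L where *: "y = (t, K)" "z = (s, L)" "(t, K) \<in> p" "(s, L) \<in> p"
         "Inf K < Sup K" "Inf L = Inf K" "Sup L = Sup K"
        by (auto simp: P_def h_def)
      show "y = z"
      proof (rule ccontr)
        assume "y \<noteq> z"
        then have "{Inf K<..<Sup K} = {}"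
          using disj[of t K s L] * by auto
        with * show False by simp
      qed
    qed
    have finP: "finite P"
      using fin by (rule rev_finite_subset) (auto simp: P_def)
    have disD: "disjoint_family_on (\<lambda>(s, t). {s<..<t}) D"
    proof -
      have "{Inf K<..<Sup K} \<inter> {Inf L<..<Sup L} = {}"
        if "(t, K) \<in> P" "(s, L) \<in> P" "h (t, K) \<noteq> h (s, L)" for t K s L
        using disj[of t K s L] that by (auto simp: P_def)
      then show ?thesis
        unfolding D_def disjoint_family_on_def by (fastforce simp: h_def)
    qed
    have Db: "a \<le> s \<and> s \<le> t \<and> t \<le> b" if "(s, t) \<in> D" for s t
      using that K by (force simp: D_def h_def P_def)
    have "(\<Sum>(s, t)\<in>D. t - s) = (\<Sum>z\<in>D. measure lebesgue (case z of (s, t) \<Rightarrow> {s<..<t}))"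
      using Db by (intro sum.cong) auto
    also have "\<dots> = measure lebesgue (\<Union>z\<in>D. case z of (s, t) \<Rightarrow> {s<..<t})"
      using finP disD
      by (intro measure_finite_Union[symmetric]) (auto simp: D_def h_def P_def less_imp_le)
    also have "\<dots> \<le> measure lebesgue U"
    proof (rule measure_mono_fmeasurable)
      have "{Inf K<..<Sup K} \<subseteq> U" if "(t, K) \<in> P" for t K
        using fineD[OF fine, of t K] K[of t K] that by (auto simp: P_def g_def)
      then show "(\<Union>z\<in>D. case z of (s, t) \<Rightarrow> {s<..<t}) \<subseteq> U"
        by (fastforce simp: D_def h_def)
      show "(\<Union>z\<in>D. case z of (s, t) \<Rightarrow> {s<..<t}) \<in> sets lebesgue"
        using finP by (intro sets.finite_UN) (auto simp: D_def)
    qed fact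
    finally have lenD: "(\<Sum>(s, t)\<in>D. t - s) < min \<delta> e"
      using mU by linarith
    then have incD: "(\<Sum>(s, t)\<in>D. norm (f t - f s)) < e"
    proof (intro \<delta> conjI disD)
      show "finite D" using finP by (simp add: D_def)
    qed (use Db in auto)
    have lenP: "(\<Sum>(t, K)\<in>P. Sup K - Inf K) < e"
      using lenD inj by (simp add: D_def sum.reindex h_def case_prod_unfold)
    have incP: "(\<Sum>(t, K)\<in>P. norm (f (Sup K) - f (Inf K))) < e"
      using incD inj by (simp add: D_def sum.reindex h_def case_prod_unfold)
    \<comment> \<open>On an interval tagged in \<open>N\<close> the increment of \<open>G\<close>
      may be as low as its Cauchy-Schwarz bound, and the growth \<open>c - e\<close> demanded there
      has either sign, whence the absolute value.\<close>
    define err where "err = (\<lambda>(t::real, K). norm u * norm (f (Sup K) - f (Inf K)) + \<bar>c - e\<bar> * (Sup K - Inf K))"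
    have step: "(c - e) * (Sup K - Inf K) - (if (t, K) \<in> P then err (t, K) else 0) \<le> G (Sup K) - G (Inf K)"
      if tK: "(t, K) \<in> p" for t K
    proof (cases "t \<in> N")
      case True
      have "\<bar>G (Sup K) - G (Inf K)\<bar> \<le> norm u * norm (f (Sup K) - f (Inf K))"
        unfolding G_def inner_diff_left[symmetric]
        by (metis Cauchy_Schwarz_ineq2 mult.commute)
      moreover have "(c - e) * (Sup K - Inf K) \<le> \<bar>c - e\<bar> * (Sup K - Inf K)"
        using K[OF tK] by (intro mult_right_mono) auto
      moreover have "Sup K = Inf K" if "(t, K) \<notin> P"
        using that True tK K[OF tK] by (force simp: P_def)
      ultimately show ?thesis
        by (auto simp: err_def)
    next
      case False
      note KK = K[OF tK]
      have t: "t \<in> {a..b} - N"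
        using KK False by auto
      have sub: "K \<subseteq> ball t (d t)"
        using fineD[OF fine tK] False by (simp add: g_def)
      have "Sup K \<in> K" "Inf K \<in> K"
        using KK by (metis atLeastAtMost_iff order.refl order.trans)+
      with sub have near: "\<bar>Sup K - t\<bar> < d t" "\<bar>Inf K - t\<bar> < d t"
        by (auto simp: dist_real_def abs_minus_commute)
      \<comment> \<open>The tag splits \<open>K\<close>, and the derivative estimate is used on both
        halves. The slopes \<open>v\<close> and \<open>w\<close> may differ; only \<open>c\<close>
        as a common lower bound matters.\<close>
      obtain v where v: "v \<ge> c" "\<bar>G (Sup K) - G t - (Sup K - t) * v\<bar> \<le> e * \<bar>Sup K - t\<bar>"
        using d[OF _ t near(1)] KK by auto
      obtain w where w: "w \<ge> c" "\<bar>G (Inf K) - G t - (Inf K - t) * w\<bar> \<le> e * \<bar>Inf K - t\<bar>"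
        using d[OF _ t near(2)] KK by auto
      have "(Sup K - t) * c \<le> (Sup K - t) * v" "(t - Inf K) * c \<le> (t - Inf K) * w"
        using KK v w by (auto intro!: mult_left_mono)
      moreover have "(Inf K - t) * w = - ((t - Inf K) * w)"
        by (simp add: algebra_simps)
      ultimately have "(Sup K - t) * c + (t - Inf K) * c - e * (Sup K - t) - e * (t - Inf K) \<le> G (Sup K) - G (Inf K)"
        using v(2) w(2) KK by (simp add: abs_le_iff)
      moreover have "(t, K) \<notin> P"
        using False by (auto simp: P_def)
      ultimately show ?thesis
        by (simp add: algebra_simps)
    qed
    have "(c - e) * (b - a) - (\<Sum>z\<in>P. err z)
        = (\<Sum>z\<in>p. (c - e) * (Sup (snd z) - Inf (snd z)) - (if z \<in> P then err z else 0))"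
    proof -
      have "(\<Sum>z\<in>p. Sup (snd z) - Inf (snd z)) = b - a"
        using additive_tagged_division_1[OF \<open>a \<le> b\<close> p, of "\<lambda>x. x"] by (simp add: case_prod_unfold)
      moreover have "(\<Sum>z\<in>p. if z \<in> P then err z else 0) = (\<Sum>z\<in>P. err z)"
        using fin by (subst sum.inter_restrict[symmetric]) (auto simp: P_def intro!: sum.cong)
      ultimately show ?thesis
        by (simp add: sum_subtractf sum_distrib_left[symmetric])
    qed
    also have "\<dots> \<le> (\<Sum>z\<in>p. G (Sup (snd z)) - G (Inf (snd z)))"
      using step by (intro sum_mono) (metis prod.collapse)
    also have "\<dots> = G b - G a"
      using additive_tagged_division_1[OF \<open>a \<le> b\<close> p, of G] by (simp add: case_prod_unfold)
    finally have 1: "(c - e) * (b - a) - (\<Sum>z\<in>P. err z) \<le> G b - G a" .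
    have "(\<Sum>z\<in>P. err z) = norm u * (\<Sum>(t, K)\<in>P. norm (f (Sup K) - f (Inf K)))
        + \<bar>c - e\<bar> * (\<Sum>(t, K)\<in>P. Sup K - Inf K)"
      by (simp add: err_def case_prod_unfold sum.distrib sum_distrib_left)
    also have "\<dots> \<le> norm u * e + (\<bar>c\<bar> + 1) * e"
      using lenP incP e by (intro add_mono mult_mono) (auto simp: case_prod_unfold P_def K intro!: sum_nonneg)
    finally show ?thesis
      using 1 by (simp add: Q_def algebra_simps)
  qed
  have "c * (b - a) \<le> G b - G a"
  proof (rule ccontr)
    assume "\<not> ?thesis"
    define \<kappa> where "\<kappa> = c * (b - a) - (G b - G a)"
    have "\<kappa> > 0" using \<open>\<not> _\<close> by (simp add: \<kappa>_def)
    define e where "e = min 1 (\<kappa> / (2 * Q))"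
    have "e > 0" "e \<le> 1" using \<open>\<kappa> > 0\<close> \<open>Q > 0\<close> by (auto simp: e_def)
    then have "\<kappa> \<le> e * Q" using main by (fastforce simp: \<kappa>_def)
    also have "\<dots> \<le> \<kappa> / (2 * Q) * Q"
      using \<open>Q > 0\<close> by (intro mult_right_mono) (auto simp: e_def)
    also have "\<dots> < \<kappa>" using \<open>\<kappa> > 0\<close> \<open>Q > 0\<close> by simp
    finally show False by simp
  qed
  then show ?thesis
    by (simp add: G_def inner_diff_left)
qed

text \<open>The one-sided bound is applied in the direction \<open>u\<close> opposite to the
  increment, with lower bound \<open>- (M * norm u)\<close> from Cauchy-Schwarz; dividing by
  \<open>norm u\<close> leaves the claim.\<close>

lemma abs_continuous_norm_increment_le:
  fixes f :: "real \<Rightarrow> 'a::euclidean_space"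
  assumes "a \<le> b" and "abs_continuous_on a b f" and "negligible N" and "0 \<le> M"
    and der: "\<And>t. t \<in> {a..b} - N \<Longrightarrow>
      \<exists>v. (f has_vector_derivative v) (at t within {a..b}) \<and> norm v \<le> M"
  shows "norm (f b - f a) \<le> M * (b - a)"
proof (cases "f b = f a")
  case True
  then show ?thesis using \<open>a \<le> b\<close> \<open>0 \<le> M\<close> by simp
next
  case False
  define u where "u = - (f b - f a)"
  have "\<exists>v. (f has_vector_derivative v) (at t within {a..b}) \<and> - (M * norm u) \<le> v \<bullet> u"
    if t: "t \<in> {a..b} - N" for t
  proof -
    obtain v where v: "(f has_vector_derivative v) (at t within {a..b})" "norm v \<le> M"
      using der[OF t] by blast
    have "\<bar>v \<bullet> u\<bar> \<le> norm v * norm u" by (rule Cauchy_Schwarz_ineq2)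
    also have "\<dots> \<le> M * norm u" using v by (intro mult_right_mono) auto
    finally show ?thesis using v by (auto simp: abs_le_iff)
  qed
  from abs_continuous_increment_ge[OF assms(1-3) this]
  moreover have "(f b - f a) \<bullet> u = - (norm u)\<^sup>2"
    by (simp add: u_def power2_norm_eq_inner inner_diff_left inner_diff_right)
  ultimately have "- (M * norm u) * (b - a) \<le> - (norm u)\<^sup>2"
    by simp
  then have "norm u * norm u \<le> norm u * (M * (b - a))"
    by (simp add: power2_eq_square algebra_simps)
  moreover have "norm u > 0" using False by (simp add: u_def)
  ultimately show ?thesis by (simp add: u_def norm_minus_commute)
qed

section \<open>Existence of integral curves of continuous vector fields\<close>

text \<open>Tonelli's approximations: with a delay \<open>\<delta>\<close>, Picard iterates are stationary on \<open>{..k * \<delta>}\<close>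
  from the \<open>k\<close>-th one on, so that no Lipschitz condition on \<open>g\<close> is needed.\<close>

lemma delayed_integral_equation:
  fixes g :: "'a::euclidean_space \<Rightarrow> 'a"
  assumes g: "continuous_on UNIV g" and M: "\<And>y. norm (g y) \<le> M" and "\<delta> > 0"
  obtains z where "\<And>s t. norm (z t - z s) \<le> M * \<bar>t - s\<bar>"
    "\<And>t. t \<le> T \<Longrightarrow> z t = x + integral {0..t} (\<lambda>s. g (z (s - \<delta>)))"
proof -
  define \<Phi> where "\<Phi> y = (\<lambda>t. x + integral {0..t} (\<lambda>s. g (y (s - \<delta>))))" for y :: "real \<Rightarrow> 'a"
  define z where "z k = (\<Phi> ^^ k) (\<lambda>t. x)" for k
  have z_Suc: "z (Suc k) = \<Phi> (z k)" for k
    by (simp add: z_def)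
  have \<Phi>_lip: "norm (\<Phi> y t - \<Phi> y s) \<le> M * \<bar>t - s\<bar>" if "continuous_on UNIV y" for y s t
  proof -
    have cont: "continuous_on A (\<lambda>s. g (y (s - \<delta>)))" for A
      by (rule continuous_on_compose2[OF g])
         (auto intro!: continuous_intros continuous_on_compose2[OF that])
    have "M \<ge> 0" using M[of 0] norm_ge_zero order_trans by blast
    have *: "norm (\<Phi> y t - \<Phi> y s) \<le> M * (t - s)" if "s \<le> t" for s t
    proof (cases "t \<le> 0")
      case True
      \<comment> \<open>For negative \<open>r\<close> the interval \<open>{0..r}\<close> is empty,
        so the iterates carry the constant history \<open>x\<close> that the delayed argument needs
        before time 0.\<close>
      have "\<Phi> y r = x" if "r \<le> 0" for r
        using that by (cases "r = 0") (auto simp: \<Phi>_def)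
      then show ?thesis
        using True that \<open>M \<ge> 0\<close> by simp
    next
      case False
      define s' where "s' = max 0 s"
      have "integral {0..s} (\<lambda>s. g (y (s - \<delta>))) = integral {0..s'} (\<lambda>s. g (y (s - \<delta>)))"
        by (auto simp: s'_def max_def)
      moreover have "integral {0..s'} (\<lambda>s. g (y (s - \<delta>))) + integral {s'..t} (\<lambda>s. g (y (s - \<delta>)))
          = integral {0..t} (\<lambda>s. g (y (s - \<delta>)))"
        using False that
        by (intro Henstock_Kurzweil_Integration.integral_combine integrable_continuous_real cont)
           (auto simp: s'_def)
      ultimately have "\<Phi> y t - \<Phi> y s = integral {s'..t} (\<lambda>s. g (y (s - \<delta>)))"
        by (simp add: \<Phi>_def algebra_simps)
      also have "norm \<dots> \<le> M * (t - s')"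
        using False that by (intro integral_bound cont M) (auto simp: s'_def)
      also have "\<dots> \<le> M * (t - s)"
        using \<open>M \<ge> 0\<close> by (intro mult_left_mono) (auto simp: s'_def)
      finally show ?thesis .
    qed
    show ?thesis
      using *[of s t] *[of t s] by (cases "s \<le> t") (auto simp: norm_minus_commute)
  qed
  have lip_cont: "continuous_on UNIV y" if "\<And>s t. norm (y t - y s) \<le> M * \<bar>t - s\<bar>" for y :: "real \<Rightarrow> 'a"
  proof -
    have "M \<ge> 0" using M[of 0] norm_ge_zero order_trans by blast
    then have "M-lipschitz_on UNIV y"
      using that by (intro lipschitz_onI) (auto simp: dist_norm)
    then show ?thesis by (rule lipschitz_on_continuous_on)
  qed
  have z_lip: "norm (z k t - z k s) \<le> M * \<bar>t - s\<bar>" for k s t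
  proof (induction k arbitrary: s t)
    case 0
    have "M \<ge> 0" using M[of 0] norm_ge_zero order_trans by blast
    then show ?case by (simp add: z_def)
  next
    case (Suc k)
    then show ?case unfolding z_Suc by (intro \<Phi>_lip lip_cont)
  qed
  have stable: "z (Suc k) t = z k t" if "t \<le> real k * \<delta>" for k t
    using that
  proof (induction k arbitrary: t)
    case 0
    then show ?case by (cases "t = 0") (auto simp: z_def \<Phi>_def)
  next
    case (Suc k)
    have "integral {0..t} (\<lambda>s. g (z (Suc k) (s - \<delta>))) = integral {0..t} (\<lambda>s. g (z k (s - \<delta>)))"
      using Suc.prems by (intro integral_cong arg_cong[where f = g] Suc.IH) (auto simp: algebra_simps)
    then show ?case
      by (simp add: z_Suc[of "Suc k"] z_Suc[of k] \<Phi>_def)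
  qed
  obtain N :: nat where "T / \<delta> < real N"
    using reals_Archimedean2 by blast
  then have N: "T \<le> real N * \<delta>"
    using \<open>\<delta> > 0\<close> by (simp add: pos_divide_less_eq)
  show ?thesis
  proof (rule that[of "z N"])
    show "norm (z N t - z N s) \<le> M * \<bar>t - s\<bar>" for s t by (rule z_lip)
    show "z N t = x + integral {0..t} (\<lambda>s. g (z N (s - \<delta>)))" if "t \<le> T" for t
      using stable[of t N] that N by (simp add: z_Suc \<Phi>_def)
  qed
qed

text \<open>The approximations with delay \<open>1 / real (Suc n)\<close> share the Lipschitz
  constant \<open>M\<close>, so by Arzela-Ascoli a subsequence converges uniformly. The delay shifts
  values by at most \<open>M / real (Suc n)\<close>, hence delayed and undelayed arguments have the
  same limit, and dominated convergence passes to the integral equation.\<close>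

lemma peano_existence:
  fixes g :: "'a::euclidean_space \<Rightarrow> 'a"
  assumes g: "continuous_on UNIV g" and M: "\<And>y. norm (g y) \<le> M"
  obtains z where "z 0 = x"
    "\<And>t. t \<in> {0..T} \<Longrightarrow> (z has_vector_derivative g (z t)) (at t within {0..T})"
proof -
  have "\<exists>z. (\<forall>s t. norm (z t - z s) \<le> M * \<bar>t - s\<bar>) \<and>
      (\<forall>t\<le>T. z t = x + integral {0..t} (\<lambda>s. g (z (s - 1 / real (Suc n)))))" for n
    by (rule delayed_integral_equation[OF g M, of "1 / real (Suc n)" T x]) auto
  then obtain Z where lip: "\<And>n s t. norm (Z n t - Z n s) \<le> M * \<bar>t - s\<bar>"
    and Z: "\<And>n t. t \<le> T \<Longrightarrow> Z n t = x + integral {0..t} (\<lambda>s. g (Z n (s - 1 / real (Suc n))))"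
    by metis
  have "M \<ge> 0" using M[of 0] norm_ge_zero order_trans by blast
  have bnd: "norm (Z n t) \<le> norm x + M * T" if "t \<in> {0..T}" for n t
  proof -
    have "norm (Z n t - Z n 0) \<le> M * T"
      using lip[of n t 0] that \<open>M \<ge> 0\<close> by (smt (verit) atLeastAtMost_iff mult_left_mono)
    moreover have "Z n 0 = x" using Z[of 0 n] that by simp
    ultimately show ?thesis
      using norm_triangle_ineq[of "Z n t - Z n 0" "Z n 0"] by simp
  qed
  have equi: "\<exists>d>0. \<forall>n y. y \<in> {0..T} \<and> norm (s - y) < d \<longrightarrow> norm (Z n s - Z n y) < e"
    if "e > 0" for s e
  proof (intro exI[of _ "e / (M + 1)"] conjI allI impI)
    show "0 < e / (M + 1)" using that \<open>M \<ge> 0\<close> by simp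
    fix n y assume y: "y \<in> {0..T} \<and> norm (s - y) < e / (M + 1)"
    have "norm (Z n s - Z n y) \<le> M * \<bar>s - y\<bar>" by (rule lip)
    also have "\<dots> \<le> (M + 1) * \<bar>s - y\<bar>" by (simp add: mult_right_mono)
    also have "\<dots> < e" using y \<open>M \<ge> 0\<close> by (simp add: pos_less_divide_eq mult.commute)
    finally show "norm (Z n s - Z n y) < e" .
  qed
  obtain z k where z: "continuous_on {0..T} z" and k: "strict_mono (k :: nat \<Rightarrow> nat)"
    and conv: "\<And>e. 0 < e \<Longrightarrow> \<exists>N. \<forall>n s. n \<ge> N \<and> s \<in> {0..T} \<longrightarrow> norm (Z (k n) s - z s) < e"
    using Arzela_Ascoli[OF compact_Icc bnd equi] by metis
  have lim: "(\<lambda>n. Z (k n) s) \<longlonglongrightarrow> z s" if "s \<in> {0..T}" for s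
    unfolding LIMSEQ_def dist_norm using conv that by meson
  have lim': "(\<lambda>n. Z (k n) (s - 1 / real (Suc (k n)))) \<longlonglongrightarrow> z s" if "s \<in> {0..T}" for s
  proof -
    have "(\<lambda>n. M * (1 / real (Suc (k n)))) \<longlonglongrightarrow> M * 0"
      using LIMSEQ_subseq_LIMSEQ[OF LIMSEQ_Suc[OF lim_1_over_n] k]
      by (intro tendsto_mult tendsto_const) (simp add: o_def)
    then have null: "(\<lambda>n. M * (1 / real (Suc (k n)))) \<longlonglongrightarrow> 0"
      by simp
    have "norm (Z (k n) (s - 1 / real (Suc (k n))) - Z (k n) s) \<le> M * (1 / real (Suc (k n)))" for n
      using lip[of "k n" "s - 1 / real (Suc (k n))" s] by simp
    then have "(\<lambda>n. Z (k n) (s - 1 / real (Suc (k n))) - Z (k n) s) \<longlonglongrightarrow> 0"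
      by (intro Lim_null_comparison[OF _ null] always_eventually allI)
    from tendsto_add[OF this lim[OF that]] show ?thesis by simp
  qed
  have eq: "z t = x + integral {0..t} (\<lambda>s. g (z s))" if t: "t \<in> {0..T}" for t
  proof (rule LIMSEQ_unique[OF lim[OF t]])
    have "(\<lambda>n. integral {0..t} (\<lambda>s. g (Z (k n) (s - 1 / real (Suc (k n))))))
        \<longlonglongrightarrow> integral {0..t} (\<lambda>s. g (z s))"
    proof (rule dominated_convergence(2)[where h = "\<lambda>_. M"])
      fix n
      have "continuous_on UNIV (Z n)" for n
        by (rule lipschitz_on_continuous_on[where L = M])
           (use lip \<open>M \<ge> 0\<close> in \<open>auto intro!: lipschitz_onI simp: dist_norm\<close>)
      then have "continuous_on {0..t} (\<lambda>s. Z (k n) (s - 1 / real (Suc (k n))))"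
        by (rule continuous_on_compose2) (auto intro!: continuous_intros)
      then show "(\<lambda>s. g (Z (k n) (s - 1 / real (Suc (k n))))) integrable_on {0..t}"
        by (intro integrable_continuous_real continuous_on_compose2[OF g]) auto
    next
      fix s assume "s \<in> {0..t}"
      then have "s \<in> {0..T}" using t by auto
      then show "(\<lambda>n. g (Z (k n) (s - 1 / real (Suc (k n))))) \<longlonglongrightarrow> g (z s)"
        by (intro continuous_on_tendsto_compose[OF g] lim') auto
    qed (auto intro!: M integrable_on_const)
    then show "(\<lambda>n. Z (k n) t) \<longlonglongrightarrow> x + integral {0..t} (\<lambda>s. g (z s))"
      using t Z[of t] by (auto intro!: tendsto_add tendsto_const)
  qed
  have contgz: "continuous_on {0..T} (\<lambda>s. g (z s))"
    by (intro continuous_on_compose2[OF g z]) auto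
  define w where "w t = x + integral {0..t} (\<lambda>s. g (z s))" for t
  show ?thesis
  proof (rule that[of w])
    show "w 0 = x" by (simp add: w_def)
    fix t assume t: "t \<in> {0..T}"
    have "(w has_vector_derivative 0 + g (z t)) (at t within {0..T})"
      unfolding w_def
      by (intro has_vector_derivative_add has_vector_derivative_const integral_has_vector_derivative contgz t)
    then show "(w has_vector_derivative g (w t)) (at t within {0..T})"
      using eq[OF t] by (simp add: w_def)
  qed
qed

section \<open>Hitting times of a level\<close>

text \<open>Used to cut a trajectory where it first meets the sphere, so that the bounds valid in
  the ball apply to the whole piece. The time is the least point of the closed set where \<phi> is
  at least \<open>R\<close>; the intermediate value theorem excludes a jump above
  \<open>R\<close>.\<close>

lemma first_hitting_time:
  fixes \<phi> :: "real \<Rightarrow> real"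
  assumes "continuous_on {a..b} \<phi>" "a \<le> b" "\<phi> a < R" "R < \<phi> b"
  obtains \<tau> where "\<tau> \<in> {a..b}" "\<phi> \<tau> = R" "\<And>t. t \<in> {a..\<tau>} \<Longrightarrow> \<phi> t \<le> R"
proof -
  define A where "A = {a..b} \<inter> \<phi> -` {R..}"
  have "closed A"
    unfolding A_def by (rule continuous_closed_preimage) (use assms in auto)
  moreover have "bounded A"
    by (rule bounded_subset[of "{a..b}"]) (auto simp: A_def)
  moreover have "b \<in> A"
    using assms by (simp add: A_def)
  ultimately obtain \<tau> where \<tau>: "\<tau> \<in> A" "\<And>t. t \<in> A \<Longrightarrow> \<tau> \<le> t"
    using compact_attains_inf[of A] by (metis compact_eq_bounded_closed empty_iff)
  have "\<exists>s\<ge>a. s \<le> \<tau> \<and> \<phi> s = R"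
    using \<tau> assms by (intro IVT' continuous_on_subset[OF assms(1)]) (auto simp: A_def)
  then obtain s where s: "a \<le> s" "s \<le> \<tau>" "\<phi> s = R" by blast
  then have "s \<in> A"
    using \<tau> by (auto simp: A_def)
  then have "s = \<tau>" using \<tau>(2) s by force
  have "\<phi> t \<le> R" if t: "t \<in> {a..\<tau>}" for t
  proof (rule ccontr)
    assume "\<not> \<phi> t \<le> R"
    then have "t \<in> A" using t \<tau>(1) by (auto simp: A_def)
    then show False using \<tau>(2) t s \<open>s = \<tau>\<close> \<open>\<not> \<phi> t \<le> R\<close> by force
  qed
  then show ?thesis
    using that[of \<tau>] \<tau>(1) s \<open>s = \<tau>\<close> by (auto simp: A_def)
qed

lemma last_hitting_time:
  fixes \<phi> :: "real \<Rightarrow> real"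
  assumes "continuous_on {a..b} \<phi>" "a \<le> b" "R < \<phi> a" "\<phi> b < R"
  obtains \<tau> where "\<tau> \<in> {a..b}" "\<phi> \<tau> = R" "\<And>t. t \<in> {\<tau>..b} \<Longrightarrow> \<phi> t \<le> R"
proof -
  have "continuous_on {-b..-a} (\<lambda>t. \<phi> (- t))"
    by (rule continuous_on_compose2[OF assms(1)]) (auto intro!: continuous_intros)
  from first_hitting_time[OF this, of R] obtain \<tau> where
    "\<tau> \<in> {-b..-a}" "\<phi> (- \<tau>) = R" "\<And>t. t \<in> {-b..\<tau>} \<Longrightarrow> \<phi> (- t) \<le> R"
    using assms by auto
  then show ?thesis
    using that[of "- \<tau>"] by (metis atLeastAtMost_iff minus_le_iff neg_le_iff_le minus_minus)
qed

section \<open>Least-norm points of nearby convex sets\<close>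

text \<open>Writing \<open>a\<close>, \<open>b\<close> for the two points of least norm, the obtuse angle at \<open>b\<close> gives
  \<open>norm (a' - b)\<^sup>2 \<le> norm a'\<^sup>2 - norm b\<^sup>2\<close> for any \<open>a'\<close> in the second set close to \<open>a\<close>.\<close>

lemma least_norm_point_holder:
  fixes A B :: "'a::euclidean_space set"
  assumes A: "convex A" "closed A" "A \<noteq> {}" and B: "convex B" "closed B" "B \<noteq> {}"
    and AB: "\<And>v. v \<in> A \<Longrightarrow> \<exists>w\<in>B. norm (v - w) \<le> \<delta>"
    and BA: "\<And>v. v \<in> B \<Longrightarrow> \<exists>w\<in>A. norm (v - w) \<le> \<delta>"
    and M: "\<And>v. v \<in> B \<Longrightarrow> norm v \<le> M" and "\<delta> \<ge> 0"
  shows "norm (closest_point A 0 - closest_point B 0) \<le> \<delta> + sqrt (4 * \<delta> * M + 4 * \<delta>\<^sup>2)"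
proof -
  define a b where "a = closest_point A 0" and "b = closest_point B 0"
  have aA: "a \<in> A" and bB: "b \<in> B"
    using A B by (auto simp: a_def b_def closest_point_in_set)
  obtain a' where a': "a' \<in> B" "norm (a - a') \<le> \<delta>" using AB[OF aA] by blast
  obtain b' where b': "b' \<in> A" "norm (b - b') \<le> \<delta>" using BA[OF bB] by blast
  have "(0 - b) \<bullet> (a' - b) \<le> 0"
    unfolding b_def using B a' by (intro closest_point_dot) auto
  then have "(norm (a' - b))\<^sup>2 \<le> (norm a')\<^sup>2 - (norm b)\<^sup>2"
    by (simp add: power2_norm_eq_inner inner_diff_left inner_diff_right inner_commute)
  \<comment> \<open>The calculation pauses for a bound on \<open>norm a'\<close>: one \<delta> is
    lost because \<open>b'\<close> competes with \<open>a\<close> in \<open>A\<close> and is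
    \<delta>-close to \<open>b\<close>, another in passing from \<open>a\<close> to
    \<open>a'\<close>.\<close>
  also have "norm a \<le> norm b'"
    using closest_point_le[OF A(2) b'(1), of 0] by (simp add: a_def)
  then have "norm a' \<le> norm b + 2 * \<delta>"
    using a'(2) b'(2) norm_triangle_ineq2[of a' a] norm_triangle_ineq2[of b' b]
    by (simp add: norm_minus_commute)
  then have "(norm a')\<^sup>2 - (norm b)\<^sup>2 \<le> (norm b + 2 * \<delta>)\<^sup>2 - (norm b)\<^sup>2"
    by (simp add: power_mono)
  also have "\<dots> = 4 * \<delta> * norm b + 4 * \<delta>\<^sup>2"
    by (simp add: power2_eq_square algebra_simps)
  also have "\<dots> \<le> 4 * \<delta> * M + 4 * \<delta>\<^sup>2"
    using M[OF bB] \<open>\<delta> \<ge> 0\<close> by (simp add: mult_left_mono)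
  finally have "norm (a' - b) \<le> sqrt (4 * \<delta> * M + 4 * \<delta>\<^sup>2)"
    by (rule real_le_rsqrt)
  then show ?thesis
    using norm_triangle_ineq[of "a - a'" "a' - b"] a'(2) by (simp add: a_def b_def)
qed

section \<open>Common frontier points of two sublevel sets\<close>

text \<open>Both reachable-set claims are instances, with \<open>\<eta> = \<xi>\<close> for the forward and \<open>\<eta> = - \<xi>\<close> for
  the reverse sets. Where the segment from a reachable point to a distant one inside a hyperplane
  \<open>(y - x) \<bullet> \<eta> = s\<close> leaves the \<open>\<rho>\<close>-set, it meets both frontiers as soon as \<open>C * s < \<mu>\<close>.\<close>

lemma frontiers_of_sublevels_meet:
  fixes x \<eta> :: "'a::euclidean_space" and X :: "'a set" and d :: "'a \<Rightarrow> ennreal"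
  defines "S \<equiv> \<lambda>\<mu>. {y \<in> X. d y < ennreal \<mu>}"
  assumes "DIM('a) \<ge> 2" and "cball x R \<subseteq> X" "R > 0" "C > 0" "\<sigma> > 0"
    and cone: "\<And>y. y \<in> S \<rho> \<Longrightarrow>
      norm (y - x) \<le> C * ((y - x) \<bullet> \<eta>) \<and> d y \<le> ennreal (C * ((y - x) \<bullet> \<eta>))"
    and reach: "\<And>s. \<lbrakk>0 < s; s \<le> \<sigma>\<rbrakk> \<Longrightarrow> \<exists>p\<in>S \<rho>. (p - x) \<bullet> \<eta> = s"
    and "r > 0" "0 < \<mu>" "\<mu> < \<rho>"
  shows "(top_of_set X frontier_of S \<rho> \<inter> top_of_set X frontier_of S \<mu> \<inter>
      {y \<in> X. norm (x - y) < r}) - {x} \<noteq> {}"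
proof -
  define s where "s = min \<sigma> (min (r / (2 * C)) (min (R / (2 * C)) (\<mu> / (2 * C))))"
  have s: "s > 0" "s \<le> \<sigma>" "C * s < r" "C * s < R" "C * s < \<mu>"
  proof -
    have "s \<le> r / (2 * C)" "s \<le> R / (2 * C)" "s \<le> \<mu> / (2 * C)"
      by (auto simp: s_def)
    then have "C * s \<le> r / 2" "C * s \<le> R / 2" "C * s \<le> \<mu> / 2"
      using \<open>C > 0\<close> by (auto simp: field_simps)
    then show "C * s < r" "C * s < R" "C * s < \<mu>"
      using assms by auto
    show "s > 0" "s \<le> \<sigma>" using assms by (auto simp: s_def)
  qed
  obtain p where p: "p \<in> S \<rho>" "(p - x) \<bullet> \<eta> = s"
    using reach s by blast
  \<comment> \<open>Dimension at least two enters here: the hyperplane has a direction in which one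
    can move away.\<close>
  obtain w where w: "w \<noteq> 0" "orthogonal \<eta> w"
    using orthogonal_to_vector_exists[OF \<open>DIM('a) \<ge> 2\<close>] by blast
  \<comment> \<open>The coefficient makes \<open>norm (q - p)\<close> equal to
    \<open>2 * C * s + 1\<close>, more than the diameter of the slice of the cone, which lies in the
    ball of radius \<open>C * s\<close> about \<open>x\<close>.\<close>
  define q where "q = p + (2 * C * s / norm w + 1 / norm w) *\<^sub>R w"
  have "norm (p - x) \<le> C * s"
    using cone[OF p(1)] p(2) by simp
  moreover have "norm (q - p) = 2 * C * s + 1"
    using w(1) s(1) \<open>C > 0\<close> by (simp add: q_def add_divide_distrib[symmetric])
  ultimately have "norm (q - x) > C * s"
    using norm_triangle_ineq4[of "q - x" "p - x"] s(1) \<open>C > 0\<close> by simp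
  moreover have q: "(q - x) \<bullet> \<eta> = s"
    using p(2) w(2) by (simp add: q_def orthogonal_def inner_commute algebra_simps)
  ultimately have "q \<notin> S \<rho>"
    using cone by fastforce
  with p(1) obtain z where z: "z \<in> closed_segment p q" "z \<in> frontier (S \<rho>)"
    using connected_Int_frontier[of "closed_segment p q" "S \<rho>"] by auto
  have zs: "(z - x) \<bullet> \<eta> = s"
  proof -
    obtain u where "z = (1 - u) *\<^sub>R p + u *\<^sub>R q"
      using z(1) by (auto simp: closed_segment_def)
    then have "z - x = (1 - u) *\<^sub>R (p - x) + u *\<^sub>R (q - x)"
      by (simp add: algebra_simps)
    then have "(z - x) \<bullet> \<eta> = (1 - u) * s + u * s"
      using p(2) q by (simp only: inner_add_left inner_scaleR_left)
    then show ?thesis by (simp add: algebra_simps)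
  qed
  have zcl: "z \<in> closure (S \<rho>)"
    using z(2) by (simp add: frontier_def)
  \<comment> \<open>The cone is closed, so its bound survives at the frontier point and keeps it
    within \<open>C * s\<close> of \<open>x\<close>, hence interior to \<open>X\<close>.\<close>
  have "closed {y. norm (y - x) \<le> C * ((y - x) \<bullet> \<eta>)}"
    by (intro closed_Collect_le continuous_intros)
  then have "closure (S \<rho>) \<subseteq> {y. norm (y - x) \<le> C * ((y - x) \<bullet> \<eta>)}"
    using cone by (intro closure_minimal) auto
  then have nz: "norm (z - x) \<le> C * s"
    using zcl zs by auto
  then have zball: "z \<in> ball x R"
    using s by (simp add: dist_norm norm_minus_commute)
  then have zX: "z \<in> X" and zint: "z \<in> interior X"
    using assms(3) by (auto intro: interiorI[of "ball x R"] simp: subset_iff less_imp_le)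
  \<comment> \<open>\<open>z\<close> comes from the frontier in the whole space; being interior to
    \<open>X\<close>, it is also approached by points of \<open>X\<close> outside the set, as the
    frontier relative to \<open>X\<close> demands.\<close>
  have zcomp: "z \<in> closure (X - S \<rho>)"
  proof -
    have "z \<in> closure (- S \<rho>)"
      using z(2) by (simp add: frontier_closures)
    then have "z \<in> closure (interior X \<inter> - S \<rho>)"
      using zint open_Int_closure_subset[of "interior X" "- S \<rho>"] by blast
    then show ?thesis
      by (rule rev_subsetD[OF _ closure_mono]) (use interior_subset in auto)
  qed
  \<comment> \<open>Knowing the cost on the hyperplane is not enough, since points of
    \<open>S \<rho>\<close> may approach \<open>z\<close> from off it; the cone estimate gives cost
    below \<mu> on the whole neighbourhood \<open>U\<close>.\<close>
  define U where "U = {y. C * ((y - x) \<bullet> \<eta>) < \<mu>}"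
  have "open U"
    unfolding U_def by (intro open_Collect_less continuous_intros)
  moreover have "z \<in> U" using zs s by (simp add: U_def)
  ultimately have "z \<in> closure (U \<inter> S \<rho>)"
    using zcl open_Int_closure_subset[of U "S \<rho>"] by blast
  moreover have "U \<inter> S \<rho> \<subseteq> S \<mu>"
  proof
    fix y assume y: "y \<in> U \<inter> S \<rho>"
    then have "d y \<le> ennreal (C * ((y - x) \<bullet> \<eta>))" using cone by blast
    also have "\<dots> < ennreal \<mu>"
      using y \<open>0 < \<mu>\<close> by (intro ennreal_lessI) (auto simp: U_def)
    finally show "y \<in> S \<mu>" using y by (simp add: S_def)
  qed
  ultimately have zcl\<mu>: "z \<in> closure (S \<mu>)"
    using closure_mono by blast
  have "S \<mu> \<subseteq> S \<rho>"
    using \<open>\<mu> < \<rho>\<close> ennreal_leI[of \<mu> \<rho>] by (auto simp: S_def intro: order.strict_trans2)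
  then have zcomp\<mu>: "z \<in> closure (X - S \<mu>)"
    using zcomp closure_mono[of "X - S \<rho>" "X - S \<mu>"] by blast
  have SX: "S \<nu> \<subseteq> X" for \<nu> by (auto simp: S_def)
  have "z \<in> top_of_set X frontier_of S \<nu>" if "z \<in> closure (S \<nu>)" "z \<in> closure (X - S \<nu>)" for \<nu>
    using that zX SX[of \<nu>]
    by (simp add: frontier_of_closures closure_of_subtopology Int_absorb1)
  moreover have "z \<noteq> x" using zs s by auto
  moreover have "norm (x - z) < r" using nz s by (simp add: norm_minus_commute)
  ultimately show ?thesis
    using zX zcl zcomp zcl\<mu> zcomp\<mu> by blast
qed

section \<open>Trajectories in a ball with uniform constants\<close>

text \<open>Reconciles the inclusion, which provides some derivative \<open>v\<close>, with the
  cost, which evaluates \<open>vector_derivative\<close>; uniqueness of the derivative on a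
  nondegenerate interval identifies the two.\<close>

lemma trajectories_derivative:
  assumes "(T, \<pi>) \<in> trajectories X F Obs y z"
  obtains N where "negligible N" "\<And>t. t \<in> {0..T} - N \<Longrightarrow>
    vector_derivative \<pi> (at t within {0..T}) \<in> F (\<pi> t) \<and>
    (\<pi> has_vector_derivative vector_derivative \<pi> (at t within {0..T})) (at t within {0..T})"
proof -
  have "AE t in lebesgue_on {0..T}. \<exists>v\<in>F (\<pi> t). (\<pi> has_vector_derivative v) (at t within {0..T})"
    using assms by (simp add: trajectories_def)
  then have "AE t in lebesgue. t \<in> {0..T} \<longrightarrow> (\<exists>v\<in>F (\<pi> t). (\<pi> has_vector_derivative v) (at t within {0..T}))"
    by (subst (asm) AE_restrict_space_iff) auto
  then obtain N where N: "N \<in> null_sets lebesgue" and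
    der: "\<And>t. t \<in> {0..T} - N \<Longrightarrow> \<exists>v\<in>F (\<pi> t). (\<pi> has_vector_derivative v) (at t within {0..T})"
    by (fastforce simp: eventually_ae_filter)
  show ?thesis
  \<comment> \<open>Removing 0 disposes of \<open>T = 0\<close>, where the interval is a single
    point and every vector is a derivative.\<close>
  proof (rule that[of "insert 0 N"])
    show "negligible (insert 0 N)"
      using N by (simp add: negligible_iff_null_sets)
    fix t assume t: "t \<in> {0..T} - insert 0 N"
    then obtain v where v: "v \<in> F (\<pi> t)" "(\<pi> has_vector_derivative v) (at t within {0..T})"
      using der by blast
    moreover have "vector_derivative \<pi> (at t within {0..T}) = v"
      using t v by (intro vector_derivative_within_closed_interval) auto
    ultimately show "vector_derivative \<pi> (at t within {0..T}) \<in> F (\<pi> t) \<and>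
       (\<pi> has_vector_derivative vector_derivative \<pi> (at t within {0..T})) (at t within {0..T})"
      by simp
  qed
qed

text \<open>Isolates what the Hamiltonian and compactness provide near \<open>x\<close>, so that the
  estimates refer to five constants instead of SH1 and SH3. In the instance built later,
  \<open>h\<close> is half the Hamiltonian at \<open>x\<close>.\<close>

locale uniform_ball =
  fixes X Obs :: "'a::euclidean_space set" and F :: "'a \<Rightarrow> 'a set"
    and \<psi> :: "'a \<times> 'a \<Rightarrow> real" and x \<xi> :: 'a and R h M m \<Psi> :: real
  assumes pos: "R > 0" "h > 0" "M > 0" "m > 0" "\<Psi> > 0"
    and free: "cball x R \<subseteq> X - Obs"
    and velocity: "\<And>y v. \<lbrakk>y \<in> cball x R; v \<in> F y\<rbrakk> \<Longrightarrow>
      norm v \<le> M \<and> h \<le> v \<bullet> \<xi> \<and> m \<le> \<psi> (y, v) \<and> \<psi> (y, v) \<le> \<Psi>"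
begin

text \<open>Only the piece over \<open>{a..b}\<close> has to lie in the ball, so the estimates can
  be used up to an exit. For the cost, the integrand is compared with \<open>m\<close> on that piece
  and with 0 elsewhere.\<close>

lemma
  assumes tr: "(T, \<pi>) \<in> trajectories X F Obs y z"
    and ab: "0 \<le> a" "a \<le> b" "b \<le> T"
    and inside: "\<And>t. t \<in> {a..b} \<Longrightarrow> \<pi> t \<in> cball x R"
  shows norm_increment_le: "norm (\<pi> b - \<pi> a) \<le> M * (b - a)"
    and height_increment_ge: "h * (b - a) \<le> (\<pi> b - \<pi> a) \<bullet> \<xi>"
    and path_cost_ge: "ennreal (m * (b - a)) \<le> path_cost \<psi> (T, \<pi>)"
proof -
  obtain N where N: "negligible N" and der: "\<And>t. t \<in> {0..T} - N \<Longrightarrow>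
      vector_derivative \<pi> (at t within {0..T}) \<in> F (\<pi> t) \<and>
      (\<pi> has_vector_derivative vector_derivative \<pi> (at t within {0..T})) (at t within {0..T})"
    using trajectories_derivative[OF tr] by metis
  have "abs_continuous_on 0 T \<pi>"
    using tr by (simp add: trajectories_def)
  then have ac: "abs_continuous_on a b \<pi>"
    using ab by (auto intro: abs_continuous_on_subset)
  have vel: "\<exists>v. (\<pi> has_vector_derivative v) (at t within {a..b}) \<and> norm v \<le> M \<and> h \<le> v \<bullet> \<xi>"
    if "t \<in> {a..b} - N" for t
  proof -
    have "(\<pi> has_vector_derivative vector_derivative \<pi> (at t within {0..T})) (at t within {a..b})"
      using der[of t] that ab by (auto intro: has_vector_derivative_within_subset)
    then show ?thesis
      using velocity[OF inside[of t]] der[of t] that ab by force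
  qed
  show "norm (\<pi> b - \<pi> a) \<le> M * (b - a)"
    using vel pos by (intro abs_continuous_norm_increment_le[OF _ ac N]) (auto simp: ab)
  show "h * (b - a) \<le> (\<pi> b - \<pi> a) \<bullet> \<xi>"
    using vel by (intro abs_continuous_increment_ge[OF _ ac N]) (auto simp: ab)
  have "ennreal (m * (b - a)) = (\<integral>\<^sup>+ t. ennreal m * indicator {a..b} t \<partial>lebesgue_on {0..T})"
  proof -
    have "{a..b} \<subseteq> {0..T}" using ab by auto
    then show ?thesis
      using ab pos
      by (simp add: nn_integral_cmult_indicator sets_restrict_space_iff emeasure_restrict_space ennreal_mult)
  qed
  also have "\<dots> \<le> (\<integral>\<^sup>+ t. ennreal (\<psi> (\<pi> t, vector_derivative \<pi> (at t within {0..T}))) \<partial>lebesgue_on {0..T})"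
  proof (rule nn_integral_mono_AE)
    have "AE t in lebesgue. t \<notin> N"
      using N by (simp add: negligible_iff_null_sets AE_not_in)
    then have "AE t in lebesgue_on {0..T}. t \<in> {0..T} - N"
      by (subst AE_restrict_space_iff) auto
    then show "AE t in lebesgue_on {0..T}. ennreal m * indicator {a..b} t
        \<le> ennreal (\<psi> (\<pi> t, vector_derivative \<pi> (at t within {0..T})))"
    proof eventually_elim
      case (elim t)
      then show ?case
        using velocity[OF inside[of t]] der[of t] by (cases "t \<in> {a..b}") (auto intro: ennreal_leI)
    qed
  qed
  finally show "ennreal (m * (b - a)) \<le> path_cost \<psi> (T, \<pi>)"
    by (simp add: path_cost_def)
qed

lemma path_cost_le:
  assumes tr: "(T, \<pi>) \<in> trajectories X F Obs y z"
    and inside: "\<And>t. t \<in> {0..T} \<Longrightarrow> \<pi> t \<in> cball x R"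
  shows "path_cost \<psi> (T, \<pi>) \<le> ennreal (\<Psi> * T)"
proof -
  obtain N where N: "negligible N" and der: "\<And>t. t \<in> {0..T} - N \<Longrightarrow>
      vector_derivative \<pi> (at t within {0..T}) \<in> F (\<pi> t)"
    using trajectories_derivative[OF tr] by metis
  have "T \<ge> 0" using tr by (simp add: trajectories_def)
  have "path_cost \<psi> (T, \<pi>) \<le> (\<integral>\<^sup>+ t. ennreal \<Psi> \<partial>lebesgue_on {0..T})"
    unfolding path_cost_def split
  proof (rule nn_integral_mono_AE)
    have "AE t in lebesgue. t \<notin> N"
      using N by (simp add: negligible_iff_null_sets AE_not_in)
    then have "AE t in lebesgue_on {0..T}. t \<in> {0..T} - N"
      by (subst AE_restrict_space_iff) auto
    then show "AE t in lebesgue_on {0..T}.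
        ennreal (\<psi> (\<pi> t, vector_derivative \<pi> (at t within {0..T}))) \<le> ennreal \<Psi>"
    proof eventually_elim
      case (elim t)
      then show ?case
        using velocity[OF inside[of t]] der[of t] by (auto intro: ennreal_leI)
    qed
  qed
  also have "\<dots> = ennreal (\<Psi> * T)"
    using \<open>T \<ge> 0\<close> pos by (simp add: emeasure_restrict_space ennreal_mult)
  finally show ?thesis .
qed

text \<open>Between \<open>x\<close> and the sphere the speed is at most \<open>M\<close>, so a
  trajectory that leaves the ball spends at least time \<open>R / M\<close> in it, at cost at least
  \<open>m * R / M\<close>. The parameter \<open>e\<close> marks the end that sits at
  \<open>x\<close>, for both time directions.\<close>

lemma cheap_trajectory_stays_inside:
  assumes tr: "(T, \<pi>) \<in> trajectories X F Obs y z"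
    and cheap: "path_cost \<psi> (T, \<pi>) < ennreal (m * R / M)"
    and e: "e = 0 \<or> e = T" "\<pi> e = x" and t: "t \<in> {0..T}"
  shows "\<pi> t \<in> cball x R"
proof (rule ccontr)
  assume "\<pi> t \<notin> cball x R"
  then have out: "dist x (\<pi> t) > R" by simp
  have "abs_continuous_on 0 T \<pi>"
    using tr by (simp add: trajectories_def)
  then have cont: "continuous_on {0..T} (\<lambda>t. dist x (\<pi> t))"
    by (intro continuous_intros abs_continuous_on_imp_continuous_on)
  have no_crossing: False
    if "0 \<le> a" "a \<le> b" "b \<le> T" and in_ab: "\<And>t. t \<in> {a..b} \<Longrightarrow> dist x (\<pi> t) \<le> R"
      and len: "norm (\<pi> b - \<pi> a) = R" for a b
  proof -
    have "R \<le> M * (b - a)"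
      using norm_increment_le[OF tr that(1-3)] in_ab len by simp
    then have "R / M \<le> b - a"
      using pos by (simp add: field_simps)
    then have "m * R / M \<le> m * (b - a)"
      using mult_left_mono[of "R / M" "b - a" m] pos by simp
    then have "ennreal (m * R / M) \<le> path_cost \<psi> (T, \<pi>)"
      using path_cost_ge[OF tr that(1-3)] in_ab by (auto intro: order_trans[OF ennreal_leI])
    then show False using cheap by simp
  qed
  from e(1) show False
  proof
    assume "e = 0"
    have "continuous_on {0..t} (\<lambda>t. dist x (\<pi> t))"
      using t by (auto intro: continuous_on_subset[OF cont])
    then obtain \<tau> where "\<tau> \<in> {0..t}" "dist x (\<pi> \<tau>) = R" "\<And>s. s \<in> {0..\<tau>} \<Longrightarrow> dist x (\<pi> s) \<le> R"
      by (rule first_hitting_time[of 0 t _ R]) (use e out t pos \<open>e = 0\<close> in auto)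
    then show False
      using no_crossing[of 0 \<tau>] t e \<open>e = 0\<close> by (auto simp: dist_norm norm_minus_commute)
  next
    assume "e = T"
    have "continuous_on {t..T} (\<lambda>t. dist x (\<pi> t))"
      using t by (auto intro: continuous_on_subset[OF cont])
    then obtain \<tau> where "\<tau> \<in> {t..T}" "dist x (\<pi> \<tau>) = R" "\<And>s. s \<in> {\<tau>..T} \<Longrightarrow> dist x (\<pi> s) \<le> R"
      by (rule last_hitting_time[of t T _ R]) (use e out t pos \<open>e = T\<close> in auto)
    then show False
      using no_crossing[of \<tau> T] t e \<open>e = T\<close> by (auto simp: dist_norm norm_minus_commute)
  qed
qed

text \<open>The duration \<open>T\<close> links all quantities: the height gained is at least
  \<open>h * T\<close>, while length and cost are at most \<open>M * T\<close> and
  \<open>\<Psi> * T\<close>. The sum in \<open>C\<close> serves both bounds with one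
  constant.\<close>

lemma reach_estimate:
  assumes cheap: "cost_dist X F Obs \<psi> y z < ennreal (m * R / M)" and "y = x \<or> z = x"
  defines "C \<equiv> (M + \<Psi>) / h"
  shows "norm (z - y) \<le> C * ((z - y) \<bullet> \<xi>)"
    and "cost_dist X F Obs \<psi> y z \<le> ennreal (C * ((z - y) \<bullet> \<xi>))"
proof -
  obtain T \<pi> where tr: "(T, \<pi>) \<in> trajectories X F Obs y z"
    and cost: "path_cost \<psi> (T, \<pi>) < ennreal (m * R / M)"
    using cheap by (auto simp: cost_dist_def INF_less_iff)
  have T: "T \<ge> 0" "\<pi> 0 = y" "\<pi> T = z"
    using tr by (auto simp: trajectories_def)
  have inside: "\<pi> t \<in> cball x R" if "t \<in> {0..T}" for t
    using assms(2) cheap_trajectory_stays_inside[OF tr cost _ _ that] T by metis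
  have up: "h * T \<le> (z - y) \<bullet> \<xi>" and len: "norm (z - y) \<le> M * T"
    using height_increment_ge[OF tr _ _ order_refl inside, of 0]
      norm_increment_le[OF tr _ _ order_refl inside, of 0] T
    by auto
  have T_le: "T \<le> (z - y) \<bullet> \<xi> / h"
    using up pos by (simp add: field_simps)
  have "M * T \<le> (M + \<Psi>) * T" "\<Psi> * T \<le> (M + \<Psi>) * T"
    using pos T by (auto intro: mult_right_mono)
  moreover have "(M + \<Psi>) * T \<le> C * ((z - y) \<bullet> \<xi>)"
    using mult_left_mono[OF T_le, of "M + \<Psi>"] pos by (simp add: C_def)
  ultimately have bounds: "M * T \<le> C * ((z - y) \<bullet> \<xi>)" "\<Psi> * T \<le> C * ((z - y) \<bullet> \<xi>)"
    by linarith+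
  show "norm (z - y) \<le> C * ((z - y) \<bullet> \<xi>)"
    using len bounds by linarith
  have "cost_dist X F Obs \<psi> y z \<le> path_cost \<psi> (T, \<pi>)"
    unfolding cost_dist_def by (intro INF_lower tr)
  also have "\<dots> \<le> ennreal (\<Psi> * T)"
    by (rule path_cost_le[OF tr inside])
  also have "\<dots> \<le> ennreal (C * ((z - y) \<bullet> \<xi>))"
    using bounds by (intro ennreal_leI)
  finally show "cost_dist X F Obs \<psi> y z \<le> ennreal (C * ((z - y) \<bullet> \<xi>))" .
qed

section \<open>Reachable points at a prescribed height\<close>

lemma trajectory_of_integral_curve:
  assumes "0 \<le> T" and der: "\<And>t. t \<in> {0..T} \<Longrightarrow>
      \<exists>v\<in>F (\<pi> t). (\<pi> has_vector_derivative v) (at t within {0..T})"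
    and lip: "\<And>s t. \<lbrakk>0 \<le> s; s \<le> t; t \<le> T\<rbrakk> \<Longrightarrow> norm (\<pi> t - \<pi> s) \<le> M * (t - s)"
    and inside: "\<And>t. t \<in> {0..T} \<Longrightarrow> \<pi> t \<in> cball x R"
  shows "(T, \<pi>) \<in> trajectories X F Obs (\<pi> 0) (\<pi> T)"
proof -
  have "AE t in lebesgue_on {0..T}. \<exists>v\<in>F (\<pi> t). (\<pi> has_vector_derivative v) (at t within {0..T})"
    using der by (intro AE_I2) (simp add: space_restrict_space)
  moreover have "\<pi> t \<in> X \<inter> closure (X - Obs)" if "t \<in> {0..T}" for t
    using inside[OF that] free closure_subset[of "X - Obs"] by auto
  ultimately show ?thesis
    using lipschitz_imp_abs_continuous_on[OF lip] \<open>0 \<le> T\<close> by (auto simp: trajectories_def)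
qed

text \<open>The sign \<open>\<sigma>\<close> treats both time directions at once.\<close>

lemma integral_curve_exists:
  assumes f: "continuous_on (cball x R) f" and fF: "\<And>y. y \<in> cball x R \<Longrightarrow> f y \<in> F y"
    and "\<bar>\<sigma>\<bar> = 1" and s: "0 < s" "s \<le> h * R / M"
  obtains T z where "0 \<le> T" "T \<le> s / h" "z 0 = x" "((z T - x) \<bullet> \<xi>) * \<sigma> = s"
    "\<And>t. t \<in> {0..T} \<Longrightarrow> z t \<in> cball x R \<and> (z has_vector_derivative \<sigma> *\<^sub>R f (z t)) (at t within {0..T})"
    "\<And>t t'. \<lbrakk>0 \<le> t'; t' \<le> t; t \<le> T\<rbrakk> \<Longrightarrow> norm (z t - z t') \<le> M * (t - t')"
proof -
  \<comment> \<open>Projecting to the ball first extends the field to a bounded continuous one on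
    the whole space. Up to time \<open>R / M\<close> a curve of speed at most \<open>M\<close> stays
    in the ball, where the projection is the identity.\<close>
  define g where "g y = \<sigma> *\<^sub>R f (closest_point (cball x R) y)" for y
  define T0 where "T0 = R / M"
  have "T0 > 0" using pos by (simp add: T0_def)
  have ne: "cball x R \<noteq> {}" using pos by auto
  have cl: "closest_point (cball x R) y \<in> cball x R" for y
    using ne by (intro closest_point_in_set) auto
  have gcont: "continuous_on UNIV g"
    unfolding g_def
    by (intro continuous_intros continuous_on_compose2[OF f] continuous_on_closest_point)
       (use cl ne in auto)
  have gM: "norm (g y) \<le> M" for y
    using velocity[OF cl fF[OF cl], of y] \<open>\<bar>\<sigma>\<bar> = 1\<close> by (simp add: g_def)
  obtain z where z0: "z 0 = x"
    and z: "\<And>t. t \<in> {0..T0} \<Longrightarrow> (z has_vector_derivative g (z t)) (at t within {0..T0})"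
    using peano_existence[OF gcont gM] by metis
  have lip: "norm (z t - z t') \<le> M * (t - t')" if "0 \<le> t'" "t' \<le> t" "t \<le> T0" for t t'
  proof -
    have "norm (z t - z t') \<le> M * norm (t - t')"
    proof (rule differentiable_bound)
      show "convex {0..T0}" by simp
      show "(z has_derivative (\<lambda>r. r *\<^sub>R g (z u))) (at u within {0..T0})" if "u \<in> {0..T0}" for u
        using z[OF that] by (simp add: has_vector_derivative_def)
      show "onorm (\<lambda>r. r *\<^sub>R g (z u)) \<le> M" for u
        using gM[of "z u"] by (intro onorm_le) (simp add: mult.commute[of M] mult_left_mono)
    qed (use that in auto)
    then show ?thesis using that by simp
  qed
  have inside: "z t \<in> cball x R" if "t \<in> {0..T0}" for t
  proof -
    have "norm (z t - z 0) \<le> M * t"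
      using lip[of 0 t] that by simp
    also have "\<dots> \<le> M * T0" using that pos by (intro mult_left_mono) auto
    finally show ?thesis using pos by (simp add: T0_def z0 dist_norm norm_minus_commute)
  qed
  then have g_eq: "g (z t) = \<sigma> *\<^sub>R f (z t)" if "t \<in> {0..T0}" for t
    using that by (simp add: g_def closest_point_self)
  have height: "h * t \<le> (z t - x) \<bullet> (\<sigma> *\<^sub>R \<xi>)" if t: "t \<in> {0..T0}" for t
  proof -
    have "h * (t - 0) \<le> (z t - z 0) \<bullet> (\<sigma> *\<^sub>R \<xi>)"
    proof (rule abs_continuous_increment_ge[where N = "{}"])
      show "abs_continuous_on 0 t z"
        using t by (intro lipschitz_imp_abs_continuous_on[of _ _ _ M] lip) auto
      fix u assume u: "u \<in> {0..t} - {}"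
      then have u0: "u \<in> {0..T0}" using t by auto
      have "\<sigma> * \<sigma> = 1" using \<open>\<bar>\<sigma>\<bar> = 1\<close> by (metis abs_mult_self_eq mult.right_neutral)
      then have "g (z u) \<bullet> (\<sigma> *\<^sub>R \<xi>) = f (z u) \<bullet> \<xi>"
        using g_eq[OF u0] by simp
      moreover have "(z has_vector_derivative g (z u)) (at u within {0..t})"
        using z[OF u0] t by (auto intro: has_vector_derivative_within_subset)
      ultimately show "\<exists>v. (z has_vector_derivative v) (at u within {0..t}) \<and> h \<le> v \<bullet> (\<sigma> *\<^sub>R \<xi>)"
        using velocity[OF inside[OF u0] fF[OF inside[OF u0]]] by auto
    qed (use t in auto)
    then show ?thesis by (simp add: z0)
  qed
  have "continuous_on {0..T0} z"
    by (intro abs_continuous_on_imp_continuous_on lipschitz_imp_abs_continuous_on[of _ _ _ M] lip) auto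
  then have "continuous_on {0..T0} (\<lambda>t. (z t - x) \<bullet> (\<sigma> *\<^sub>R \<xi>))"
    by (intro continuous_intros)
  \<comment> \<open>At time \<open>T0\<close> the height is at least \<open>h * R / M\<close>; this
    is where the bound on \<open>s\<close> comes from, and the intermediate value theorem then hits
    \<open>s\<close> exactly.\<close>
  moreover have "s \<le> (z T0 - x) \<bullet> (\<sigma> *\<^sub>R \<xi>)"
    using height[of T0] s \<open>T0 > 0\<close> by (simp add: T0_def)
  ultimately obtain T where T: "0 \<le> T" "T \<le> T0" "(z T - x) \<bullet> (\<sigma> *\<^sub>R \<xi>) = s"
    using IVT'[of "\<lambda>t. (z t - x) \<bullet> (\<sigma> *\<^sub>R \<xi>)" 0 s T0] s \<open>T0 > 0\<close> z0 by auto
  show ?thesis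
  proof (rule that[of T z])
    show "T \<le> s / h"
      using height[of T] T pos by (simp add: field_simps)
    show "((z T - x) \<bullet> \<xi>) * \<sigma> = s"
      using T(3) by (simp add: mult.commute)
    show "z t \<in> cball x R \<and> (z has_vector_derivative \<sigma> *\<^sub>R f (z t)) (at t within {0..T})"
      if "t \<in> {0..T}" for t
    proof -
      have "t \<in> {0..T0}" using that T by auto
      then show ?thesis
        using z[of t] inside[of t] g_eq[of t] T(2)
        by (auto intro: has_vector_derivative_within_subset)
    qed
  qed (use T z0 lip in auto)
qed

lemma cost_dist_le:
  assumes "(T, \<pi>) \<in> trajectories X F Obs y z" "\<And>t. t \<in> {0..T} \<Longrightarrow> \<pi> t \<in> cball x R"
    and "T \<le> s / h"
  shows "cost_dist X F Obs \<psi> y z \<le> ennreal (\<Psi> * (s / h))"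
proof -
  have "cost_dist X F Obs \<psi> y z \<le> path_cost \<psi> (T, \<pi>)"
    unfolding cost_dist_def by (intro INF_lower assms)
  also have "\<dots> \<le> ennreal (\<Psi> * T)"
    using assms by (intro path_cost_le)
  also have "\<dots> \<le> ennreal (\<Psi> * (s / h))"
    using assms pos by (intro ennreal_leI mult_left_mono) auto
  finally show ?thesis .
qed

lemma forward_point_exists:
  assumes f: "continuous_on (cball x R) f" "\<And>y. y \<in> cball x R \<Longrightarrow> f y \<in> F y"
    and s: "0 < s" "s \<le> h * R / M"
  shows "\<exists>p\<in>X. (p - x) \<bullet> \<xi> = s \<and> cost_dist X F Obs \<psi> x p \<le> ennreal (\<Psi> * (s / h))"
proof -
  obtain T z where T: "0 \<le> T" "T \<le> s / h" and z0: "z 0 = x" and zT: "(z T - x) \<bullet> \<xi> = s"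
    and z: "\<And>t. t \<in> {0..T} \<Longrightarrow> z t \<in> cball x R \<and> (z has_vector_derivative f (z t)) (at t within {0..T})"
    and lip: "\<And>t t'. \<lbrakk>0 \<le> t'; t' \<le> t; t \<le> T\<rbrakk> \<Longrightarrow> norm (z t - z t') \<le> M * (t - t')"
    using integral_curve_exists[OF f, of 1 s] s by (simp, blast)
  have "(T, z) \<in> trajectories X F Obs x (z T)"
    using trajectory_of_integral_curve[OF T(1) _ lip] z f(2) by (force simp: z0)
  then have "cost_dist X F Obs \<psi> x (z T) \<le> ennreal (\<Psi> * (s / h))"
    using z T by (intro cost_dist_le) auto
  moreover have "z T \<in> X" using z[of T] T free by auto
  ultimately show ?thesis using zT by blast
qed

text \<open>An integral curve of \<open>- f\<close> starting at \<open>x\<close>, run backwards, is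
  an admissible trajectory ending at \<open>x\<close>.\<close>

lemma reverse_point_exists:
  assumes f: "continuous_on (cball x R) f" "\<And>y. y \<in> cball x R \<Longrightarrow> f y \<in> F y"
    and s: "0 < s" "s \<le> h * R / M"
  shows "\<exists>p\<in>X. (p - x) \<bullet> (- \<xi>) = s \<and> cost_dist X F Obs \<psi> p x \<le> ennreal (\<Psi> * (s / h))"
proof -
  obtain T z where T: "0 \<le> T" "T \<le> s / h" and z0: "z 0 = x" and zT: "(z T - x) \<bullet> (- \<xi>) = s"
    and z: "\<And>t. t \<in> {0..T} \<Longrightarrow> z t \<in> cball x R \<and> (z has_vector_derivative - f (z t)) (at t within {0..T})"
    and lip: "\<And>t t'. \<lbrakk>0 \<le> t'; t' \<le> t; t \<le> T\<rbrakk> \<Longrightarrow> norm (z t - z t') \<le> M * (t - t')"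
    using integral_curve_exists[OF f, of "-1" s] s by (simp, blast)
  define w where "w t = z (T - t)" for t
  have "(w has_vector_derivative f (w t)) (at t within {0..T})" if t: "t \<in> {0..T}" for t
  proof -
    have "((\<lambda>t. T - t) has_vector_derivative -1) (at t within {0..T})"
      by (auto intro!: derivative_eq_intros)
    moreover have "(\<lambda>t. T - t) ` {0..T} \<subseteq> {0..T}" by auto
    then have "(z has_vector_derivative - f (z (T - t))) (at (T - t) within (\<lambda>t. T - t) ` {0..T})"
      using z[of "T - t"] t by (auto intro: has_vector_derivative_within_subset)
    ultimately have "(z \<circ> (\<lambda>t. T - t) has_vector_derivative -1 *\<^sub>R (- f (z (T - t)))) (at t within {0..T})"
      by (rule vector_diff_chain_within)
    then show ?thesis by (simp add: w_def[abs_def] o_def)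
  qed
  moreover have inside: "w t \<in> cball x R" if "t \<in> {0..T}" for t
    using z[of "T - t"] that by (simp add: w_def)
  moreover have "norm (w t - w t') \<le> M * (t - t')" if "0 \<le> t'" "t' \<le> t" "t \<le> T" for t t'
    using lip[of "T - t" "T - t'"] that by (simp add: w_def norm_minus_commute)
  ultimately have "(T, w) \<in> trajectories X F Obs (w 0) (w T)"
    using f(2) T(1) by (intro trajectory_of_integral_curve bexI[where x = "f (w _)"]) auto
  then have "cost_dist X F Obs \<psi> (z T) x \<le> ennreal (\<Psi> * (s / h))"
    using inside T by (intro cost_dist_le) (auto simp: w_def z0)
  moreover have "z T \<in> X" using z[of T] T free by auto
  ultimately show ?thesis using zT by blast
qed

end

section \<open>From the standing hypotheses to the uniform ball\<close>

lemma SH1_closed_values: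
  assumes "SH1 X F" and "closed X" "y \<in> X"
  shows "closed (F y)"
proof -
  have "closedin (top_of_set (X \<times> X)) {(x, v). x \<in> X \<and> v \<in> F x}"
    using assms(1) by (simp add: SH1_def)
  then have "closed {(x, v). x \<in> X \<and> v \<in> F x}"
    by (rule closedin_closed_trans) (intro closed_Times assms(2))
  then have "closed (Pair y -` {(x, v). x \<in> X \<and> v \<in> F x})"
    by (intro closed_vimage continuous_intros)
  moreover have "Pair y -` {(x, v). x \<in> X \<and> v \<in> F x} = F y"
    using assms(3) by auto
  ultimately show ?thesis by simp
qed

lemma SH3_nearby_velocity:
  assumes "SH3 X F" "K \<subseteq> X" "compact K"
  obtains k where "k > 0"
    "\<And>y z v. \<lbrakk>y \<in> K; z \<in> K; v \<in> F y\<rbrakk> \<Longrightarrow> \<exists>w\<in>F z. norm (v - w) \<le> k * norm (y - z)"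
proof -
  obtain k where "k > 0" and k: "\<forall>x\<in>K. \<forall>y\<in>K.
      F x \<subseteq> {w + (k * norm (x - y)) *\<^sub>R b | w b. w \<in> F y \<and> b \<in> cball 0 1}"
    using assms unfolding SH3_def by blast
  have "\<exists>w\<in>F z. norm (v - w) \<le> k * norm (y - z)" if yz: "y \<in> K" "z \<in> K" and v: "v \<in> F y" for y z v
  proof -
    obtain w b where "v = w + (k * norm (y - z)) *\<^sub>R b" "w \<in> F z" "norm b \<le> 1"
      using k yz v by (force simp: dist_norm)
    moreover from this have "norm (v - w) \<le> k * norm (y - z)"
      using \<open>k > 0\<close> by (simp add: abs_mult mult_left_le)
    ultimately show ?thesis by blast
  qed
  with \<open>k > 0\<close> show ?thesis using that by blast
qed

lemma SH1_bounded_velocities: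
  assumes "SH1 X F" "K \<subseteq> X" "compact K"
  obtains M where "M > 0" "\<And>y v. \<lbrakk>y \<in> K; v \<in> F y\<rbrakk> \<Longrightarrow> norm v \<le> M"
proof -
  have "\<exists>M>0. \<forall>y\<in>K. \<forall>v\<in>F y. norm v \<le> M"
    using assms by (simp add: SH1_def)
  then show ?thesis using that by blast
qed

text \<open>SH3, read in both directions, says that the values at \<open>y\<close> and
  \<open>z\<close> are within \<open>k * norm (z - y)\<close> of each other; the estimate for
  least-norm points turns this into the modulus \<open>e\<close>, which vanishes at
  \<open>y\<close>.\<close>

lemma least_norm_selection_continuous:
  assumes "SH1 X F" "SH3 X F" "closed X"
    and K: "K \<subseteq> X" "compact K"
  shows "continuous_on K (\<lambda>y. closest_point (F y) 0)"
  unfolding continuous_on_def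
proof
  fix y assume y: "y \<in> K"
  have F: "convex (F z)" "closed (F z)" "F z \<noteq> {}" if "z \<in> K" for z
    using that assms SH1_closed_values[OF assms(1,3)] by (auto simp: SH1_def)
  obtain M where M: "\<And>z v. \<lbrakk>z \<in> K; v \<in> F z\<rbrakk> \<Longrightarrow> norm v \<le> M"
    using SH1_bounded_velocities[OF assms(1) K] by metis
  obtain k where "k > 0" and
    k: "\<And>y z v. \<lbrakk>y \<in> K; z \<in> K; v \<in> F y\<rbrakk> \<Longrightarrow> \<exists>w\<in>F z. norm (v - w) \<le> k * norm (y - z)"
    using SH3_nearby_velocity[OF assms(2) K] by metis
  define e where "e z = k * norm (z - y) + sqrt (4 * (k * norm (z - y)) * M + 4 * (k * norm (z - y))\<^sup>2)" for z
  have "norm (closest_point (F z) 0 - closest_point (F y) 0) \<le> e z" if z: "z \<in> K" for z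
    unfolding e_def
  proof (rule least_norm_point_holder)
    show "\<exists>w\<in>F z. norm (v - w) \<le> k * norm (z - y)" if "v \<in> F y" for v
      using k[OF y z that] by (simp add: norm_minus_commute)
  qed (use F k M y z \<open>k > 0\<close> in auto)
  then have "\<forall>\<^sub>F z in at y within K. norm (closest_point (F z) 0 - closest_point (F y) 0) \<le> e z"
    by (simp add: eventually_at_filter)
  moreover have "(e \<longlongrightarrow> e y) (at y within K)"
    unfolding e_def by (intro tendsto_intros)
  then have "(e \<longlongrightarrow> 0) (at y within K)"
    by (simp add: e_def)
  ultimately have "((\<lambda>z. closest_point (F z) 0 - closest_point (F y) 0) \<longlongrightarrow> 0) (at y within K)"
    by (rule Lim_null_comparison)
  then show "((\<lambda>z. closest_point (F z) 0) \<longlongrightarrow> closest_point (F y) 0) (at y within K)"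
    by (simp add: Lim_null[symmetric])
qed

lemma uniform_ball_exists:
  assumes "closed X" and FX: "\<And>y. y \<in> X \<Longrightarrow> F y \<subseteq> X"
    and SH: "SH1 X F" "SH3 X F"
    and \<psi>: "continuous_on (X \<times> X) \<psi>" "\<And>p. p \<in> X \<times> X \<Longrightarrow> 0 < \<psi> p"
    and Obs: "closedin (top_of_set X) Obs"
    and x: "x \<in> X - Obs" "x \<in> interior X"
    and \<xi>: "min_hamiltonian F x \<xi> > 0"
  obtains R h M m \<Psi> where "uniform_ball X Obs F \<psi> x \<xi> R h M m \<Psi>"
proof -
  have "closed Obs"
    using Obs \<open>closed X\<close> closedin_closed_trans by blast
  then have "open (interior X - Obs)" by (simp add: open_Diff)
  then obtain R0 where "R0 > 0" and R0: "cball x R0 \<subseteq> interior X - Obs"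
    using x open_contains_cball by blast
  define K where "K = cball x R0"
  have K: "K \<subseteq> X" "compact K" "x \<in> K"
    using R0 \<open>R0 > 0\<close> interior_subset by (auto simp: K_def)
  obtain M where "M > 0" and M: "\<And>z v. \<lbrakk>z \<in> K; v \<in> F z\<rbrakk> \<Longrightarrow> norm v \<le> M"
    using SH1_bounded_velocities[OF SH(1) K(1,2)] by metis
  obtain k where "k > 0" and
    k: "\<And>y z v. \<lbrakk>y \<in> K; z \<in> K; v \<in> F y\<rbrakk> \<Longrightarrow> \<exists>w\<in>F z. norm (v - w) \<le> k * norm (y - z)"
    using SH3_nearby_velocity[OF SH(2) K(1,2)] by metis
  define h where "h = min_hamiltonian F x \<xi>"
  have hx: "h \<le> v \<bullet> \<xi>" if "v \<in> F x" for v
  proof -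
    \<comment> \<open>The real infimum in \<open>min_hamiltonian\<close> is a lower bound only once
      the set is known to be bounded below.\<close>
    have "bdd_below ((\<lambda>v. v \<bullet> \<xi>) ` F x)"
    proof (rule bdd_belowI2)
      fix v assume "v \<in> F x"
      then have "norm v * norm \<xi> \<le> M * norm \<xi>"
        using M K(3) by (intro mult_right_mono) auto
      then show "- (M * norm \<xi>) \<le> v \<bullet> \<xi>"
        using Cauchy_Schwarz_ineq2[of v \<xi>] by linarith
    qed
    then show ?thesis
      unfolding h_def min_hamiltonian_def by (intro cINF_lower that)
  qed
  \<comment> \<open>Over distance \<open>R\<close> the Lipschitz condition changes
    \<open>v \<bullet> \<xi>\<close> by at most \<open>k * R * norm \<xi>\<close>; this radius keeps
    the loss below half of \<open>h\<close>.\<close>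
  define R where "R = min R0 (h / (2 * k * (norm \<xi> + 1)))"
  have "h > 0" using \<xi> by (simp add: h_def)
  then have "R > 0"
    using \<open>R0 > 0\<close> \<open>k > 0\<close> by (simp add: R_def add_nonneg_pos)
  have RK: "cball x R \<subseteq> K" by (simp add: K_def R_def subset_cball)
  have speed: "h / 2 \<le> v \<bullet> \<xi>" if y: "y \<in> cball x R" and v: "v \<in> F y" for y v
  proof -
    obtain w where w: "w \<in> F x" "norm (v - w) \<le> k * norm (y - x)"
      using k[of y x v] y v RK K(3) by blast
    have "k * norm (y - x) \<le> k * R"
      using y \<open>k > 0\<close> by (simp add: dist_norm norm_minus_commute)
    then have "norm (v - w) \<le> k * R" using w(2) by linarith
    have "\<bar>(v - w) \<bullet> \<xi>\<bar> \<le> norm (v - w) * norm \<xi>" by (rule Cauchy_Schwarz_ineq2)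
    also have "\<dots> \<le> k * R * (norm \<xi> + 1)"
      using \<open>norm (v - w) \<le> k * R\<close> \<open>k > 0\<close> \<open>R > 0\<close> by (intro mult_mono) auto
    also have "\<dots> \<le> h / 2"
    proof -
      have "2 * k * (norm \<xi> + 1) > 0"
        using \<open>k > 0\<close> by (simp add: add_nonneg_pos)
      moreover have "R \<le> h / (2 * k * (norm \<xi> + 1))" by (simp add: R_def)
      ultimately have "R * (2 * k * (norm \<xi> + 1)) \<le> h" by (simp only: pos_le_divide_eq)
      then show ?thesis by (simp add: algebra_simps)
    qed
    finally show ?thesis
      using hx[OF w(1)] unfolding inner_diff_left by linarith
  qed
  \<comment> \<open>The running cost is controlled on \<open>X \<times> X\<close> only, so
    velocities are confined to \<open>X\<close> as well as to the ball of radius \<open>M\<close>;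
    closedness of \<open>X\<close> makes \<open>L\<close> compact.\<close>
  define L where "L = K \<times> (X \<inter> cball 0 M)"
  have "compact L"
    unfolding L_def using K \<open>closed X\<close> by (intro compact_Times closed_Int_compact) auto
  have "L \<subseteq> X \<times> X" using K by (auto simp: L_def)
  have inL: "(y, v) \<in> L" if "y \<in> K" "v \<in> F y" for y v
    using that K FX M by (auto simp: L_def)
  have "F x \<noteq> {}" using SH(1) x by (auto simp: SH1_def)
  then have "L \<noteq> {}" using inL K by blast
  have cont: "continuous_on L \<psi>"
    using \<psi>(1) \<open>L \<subseteq> X \<times> X\<close> continuous_on_subset by blast
  obtain p where p: "p \<in> L" "\<And>q. q \<in> L \<Longrightarrow> \<psi> p \<le> \<psi> q"
    using continuous_attains_inf[OF \<open>compact L\<close> \<open>L \<noteq> {}\<close> cont] by blast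
  obtain p' where p': "p' \<in> L" "\<And>q. q \<in> L \<Longrightarrow> \<psi> q \<le> \<psi> p'"
    using continuous_attains_sup[OF \<open>compact L\<close> \<open>L \<noteq> {}\<close> cont] by blast
  have "uniform_ball X Obs F \<psi> x \<xi> R (h / 2) M (\<psi> p) (\<psi> p')"
  proof
    show "0 < \<psi> p" "0 < \<psi> p'" using p p' \<psi>(2) \<open>L \<subseteq> X \<times> X\<close> by auto
    show "cball x R \<subseteq> X - Obs"
      using RK R0 interior_subset[of X] by (auto simp: K_def)
    show "norm v \<le> M \<and> h / 2 \<le> v \<bullet> \<xi> \<and> \<psi> p \<le> \<psi> (y, v) \<and> \<psi> (y, v) \<le> \<psi> p'"
      if "y \<in> cball x R" "v \<in> F y" for y v
      using that speed M RK inL p(2) p'(2) by blast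
  qed (use \<open>R > 0\<close> \<open>h > 0\<close> \<open>M > 0\<close> in auto)
  then show ?thesis by (rule that)
qed

theorem theorem3p5:
  fixes X Obs :: "'a::euclidean_space set"
    and F :: "'a \<Rightarrow> 'a set"
    and \<psi> :: "'a \<times> 'a \<Rightarrow> real"
    and x \<xi> :: 'a
  assumes "DIM('a) \<ge> 2"
    and "closed X"
    and "\<And>y. y \<in> X \<Longrightarrow> F y \<subseteq> X"
    and "SH1 X F" and "SH2 X F" and "SH3 X F"
    and "continuous_on (X \<times> X) \<psi>"
    and "\<And>p. p \<in> X \<times> X \<Longrightarrow> 0 < \<psi> p"
    and "closedin (top_of_set X) Obs"
    and "x \<in> X - Obs" and "x \<in> interior X"
    and "\<xi> \<in> X" and "\<xi> \<noteq> 0"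
    and "min_hamiltonian F x \<xi> > 0"
  shows "\<forall>r>0. \<exists>\<rho>>0.
    (\<forall>\<mu>. 0 < \<mu> \<and> \<mu> < \<rho> \<longrightarrow>
       (top_of_set X frontier_of reverse_reach X F Obs \<psi> \<rho> x \<inter>
        top_of_set X frontier_of reverse_reach X F Obs \<psi> \<mu> x \<inter>
        {y \<in> X. norm (x - y) < r}) - {x} \<noteq> {}) \<and>
    (\<forall>\<mu>. 0 < \<mu> \<and> \<mu> < \<rho> \<longrightarrow>
       (top_of_set X frontier_of forward_reach X F Obs \<psi> \<rho> x \<inter>
        top_of_set X frontier_of forward_reach X F Obs \<psi> \<mu> x \<inter>
        {y \<in> X. norm (x - y) < r}) - {x} \<noteq> {})"
proof -
  obtain R h M m \<Psi> where ball: "uniform_ball X Obs F \<psi> x \<xi> R h M m \<Psi>"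
    by (rule uniform_ball_exists[of X F \<psi> Obs x \<xi>]) (use assms in auto)
  interpret uniform_ball X Obs F \<psi> x \<xi> R h M m \<Psi> by (rule ball)
  define f where "f y = closest_point (F y) 0" for y
  have ballX: "cball x R \<subseteq> X" using free by blast
  have f: "continuous_on (cball x R) f"
    unfolding f_def
    by (intro least_norm_selection_continuous[OF assms(4,6,2)] ballX compact_cball)
  have fF: "f y \<in> F y" if "y \<in> cball x R" for y
  proof -
    have "y \<in> X" using that ballX by blast
    then show ?thesis
      unfolding f_def using assms(4) SH1_closed_values[OF assms(4,2)]
      by (intro closest_point_in_set) (auto simp: SH1_def)
  qed
  define \<rho> where "\<rho> = m * R / M"
  define C where "C = (M + \<Psi>) / h"
  \<comment> \<open>The first entry lets the integral curve reach height \<open>s\<close> inside the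
    ball; the second makes its cost bound \<open>\<Psi> * (s / h)\<close> at most half of
    \<rho>.\<close>
  define s0 where "s0 = min (h * R / M) (\<rho> * h / (2 * \<Psi>))"
  have posC: "\<rho> > 0" "C > 0" "s0 > 0"
    using pos by (auto simp: \<rho>_def C_def s0_def)
  have cheap_cost: "ennreal (\<Psi> * (s / h)) < ennreal \<rho>" if "s \<le> s0" for s
  proof (rule ennreal_lessI[OF posC(1)])
    have "s \<le> \<rho> * h / (2 * \<Psi>)" using that by (simp add: s0_def)
    then have "\<Psi> * (s / h) \<le> \<rho> / 2" using pos by (simp add: field_simps)
    then show "\<Psi> * (s / h) < \<rho>" using posC(1) by linarith
  qed
  have "(top_of_set X frontier_of reverse_reach X F Obs \<psi> \<rho> x \<inter>
      top_of_set X frontier_of reverse_reach X F Obs \<psi> \<mu> x \<inter> {y \<in> X. norm (x - y) < r}) - {x} \<noteq> {}"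
    if "r > 0" "0 < \<mu>" "\<mu> < \<rho>" for r \<mu>
    unfolding reverse_reach_def
  proof (rule frontiers_of_sublevels_meet[where R = R and C = C and \<eta> = "- \<xi>" and \<sigma> = s0])
    fix y assume "y \<in> {y \<in> X. cost_dist X F Obs \<psi> y x < ennreal \<rho>}"
    then show "norm (y - x) \<le> C * ((y - x) \<bullet> - \<xi>) \<and>
        cost_dist X F Obs \<psi> y x \<le> ennreal (C * ((y - x) \<bullet> - \<xi>))"
      \<comment> \<open>Here the displacement along the trajectory is \<open>x - y\<close>, which is
        why the reverse sets open in the direction \<open>- \<xi>\<close>.\<close>
      using reach_estimate[of y x]
      by (simp add: \<rho>_def C_def norm_minus_commute inner_diff_left)
  next
    fix s assume s: "0 < s" "s \<le> s0"
    then obtain p where "p \<in> X" "(p - x) \<bullet> (- \<xi>) = s"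
      "cost_dist X F Obs \<psi> p x \<le> ennreal (\<Psi> * (s / h))"
      using reverse_point_exists[OF f fF, of s] by (auto simp: s0_def)
    then show "\<exists>p\<in>{y \<in> X. cost_dist X F Obs \<psi> y x < ennreal \<rho>}. (p - x) \<bullet> (- \<xi>) = s"
      using cheap_cost[OF s(2)] by (auto intro: order.strict_trans1)
  qed (use assms(1) ballX pos posC that in auto)
  moreover have "(top_of_set X frontier_of forward_reach X F Obs \<psi> \<rho> x \<inter>
      top_of_set X frontier_of forward_reach X F Obs \<psi> \<mu> x \<inter> {y \<in> X. norm (x - y) < r}) - {x} \<noteq> {}"
    if "r > 0" "0 < \<mu>" "\<mu> < \<rho>" for r \<mu>
    unfolding forward_reach_def
  proof (rule frontiers_of_sublevels_meet[where R = R and C = C and \<eta> = \<xi> and \<sigma> = s0])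
    fix y assume "y \<in> {y \<in> X. cost_dist X F Obs \<psi> x y < ennreal \<rho>}"
    then show "norm (y - x) \<le> C * ((y - x) \<bullet> \<xi>) \<and>
        cost_dist X F Obs \<psi> x y \<le> ennreal (C * ((y - x) \<bullet> \<xi>))"
      using reach_estimate[of x y] by (simp add: \<rho>_def C_def)
  next
    fix s assume s: "0 < s" "s \<le> s0"
    then obtain p where "p \<in> X" "(p - x) \<bullet> \<xi> = s"
      "cost_dist X F Obs \<psi> x p \<le> ennreal (\<Psi> * (s / h))"
      using forward_point_exists[OF f fF, of s] by (auto simp: s0_def)
    then show "\<exists>p\<in>{y \<in> X. cost_dist X F Obs \<psi> x y < ennreal \<rho>}. (p - x) \<bullet> \<xi> = s"
      using cheap_cost[OF s(2)] by (auto intro: order.strict_trans1)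
  qed (use assms(1) ballX pos posC that in auto)
  ultimately show ?thesis
    using posC(1) by blast
qed

end
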